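(* Let $\lambda_0\in\mathbb C$ with $\operatorname{Re}(\lambda_0)>0$ and let $$\alpha(\mu)=\operatorname{Re}(\lambda_0)\mu,\qquad \beta(\mu)=-\operatorname{Im}(\lambda_0)\mu+1,$$ so that $\lambda(\mu)=\lambda_0\mu-\mathrm i$, $\nu(\mu)=\overline{\lambda_0}\mu+\mathrm i$ and $\mu_*=\mathrm i/\lambda_0$. Then (A1)–(A3) and (B1)–(B3) all hold true (with $\mu_s=-\mu_u=-|\lambda_0|^{-1}$) if and only if $$\operatorname{Re}(\lambda_0)>\sqrt3\,|\operatorname{Im}(\lambda_0)|.$$
   Context: Here $\lambda=\alpha-\mathrm i\beta$, $\nu=\alpha+\mathrm i\beta$ are the (complexified) eigenvalues associated with the system $x'=\alpha(\mu)x+\beta(\mu)y+\epsilon R(x,y,\mu,\epsilon)$, $y'=-\beta(\mu)x+\alpha(\mu)y+\epsilon S(x,y,\mu,\epsilon)$, $\mu'=\epsilon$. Let $\Sigma=[-C_1,C_2]\times\mathrm i[-C_3,C_4]\subset\mathbb C$, $C_j>0$, be a strip, taken sufficiently large. The elliptic system is the planar real flow $\dot\mu=-\mathrm i\,\overline{\lambda(\mu)}$ on $\Sigma$. Let $\mathcal C=\{\mu\in\Sigma:\operatorname{Re}[-\mathrm i\,\overline{\lambda(\mu)}\,\nu(\mu)]=0\}$. (A1) $\lambda$ has a single root $\mu_*$ in $\Sigma$, and it is simple; moreover $\operatorname{Re}\lambda(\mu)\gtrless0$ for $\mu\gtrless0$, respectively, in $\Sigma\cap\mathbb R$. (Then $\mu_*$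 is a hyperbolic saddle of the elliptic system.) (A2) The stable manifold of $\mu_*$ (elliptic system) intersects the real axis in a unique point $\mu_s\in\Sigma$, with $\mu_s<0$. (A3) The unstable manifold of $\mu_*$ intersects the real axis in a unique point $\mu_u\in\Sigma$, with $\mu_u>0$. (B1) $\mathcal C$ contains a smooth connected 1-dimensional manifold with boundary $\mathcal C_*$ which contains $\mu=0$ and has $\mu_*$ and $\overline{\mu_*}$ as its boundary points (a smooth curve without self-intersections connecting $\mu_*$ with $\overline{\mu_*}$ through $0$). Moreover the differential of $(a,b)\mapsto\operatorname{Re}[-\mathrm i\,\overline{\lambda(a+\mathrm ib)}\,\nu(a+\mathrm ib)]$ is non-zero at every $a+\mathrm ib\in\mathcal C_*$. (B2) $\mathcal C_*$ is non-tangent to the stable and unstable manifolds of $\mu_*$ at $\mu_*$, and the elliptic flow intersects the interior of $\mathcal C_*$ transversely (no contact points). (B3) $\mathcal C_*$ is the only component of $\mathcal C$ in the region bounded by the branches of the stable and unstable manifolds of $\mu_*$ and the real axis. *)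

theory Defs
  imports "HOL-Complex_Analysis.Complex_Analysis"
begin

text \<open>
  The coefficients \<open>\<alpha>\<close>, \<open>\<beta>\<close> are taken in their complexified form.
  The hypotheses depend on them only through the eigenvalues \<open>lam\<close> and \<open>nu\<close>.
\<close>

definition eig_lam :: "(complex \<Rightarrow> complex) \<Rightarrow> (complex \<Rightarrow> complex) \<Rightarrow> complex \<Rightarrow> complex" where
  "eig_lam \<alpha> \<beta> \<mu> = \<alpha> \<mu> - \<i> * \<beta> \<mu>"

definition eig_nu :: "(complex \<Rightarrow> complex) \<Rightarrow> (complex \<Rightarrow> complex) \<Rightarrow> complex \<Rightarrow> complex" where
  "eig_nu \<alpha> \<beta> \<mu> = \<alpha> \<mu> + \<i> * \<beta> \<mu>"

definition strip :: "real \<Rightarrow> real \<Rightarrow> real \<Rightarrow> real \<Rightarrow> complex set" where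
  "strip C1 C2 C3 C4 = {\<mu>. Re \<mu> \<in> {-C1..C2} \<and> Im \<mu> \<in> {-C3..C4}}"

definition elliptic_field :: "(complex \<Rightarrow> complex) \<Rightarrow> complex \<Rightarrow> complex" where
  "elliptic_field lam \<mu> = - \<i> * cnj (lam \<mu>)"

definition elliptic_trajectory ::
    "(complex \<Rightarrow> complex) \<Rightarrow> complex set \<Rightarrow> real set \<Rightarrow> (real \<Rightarrow> complex) \<Rightarrow> bool" where
  "elliptic_trajectory lam S T \<gamma> \<longleftrightarrow>
     (\<forall>t\<in>T. \<gamma> t \<in> S \<and> (\<gamma> has_vector_derivative elliptic_field lam (\<gamma> t)) (at t within T))"

definition stable_manifold :: "(complex \<Rightarrow> complex) \<Rightarrow> complex set \<Rightarrow> complex \<Rightarrow> complex set" where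
  "stable_manifold lam S p =
     {z. \<exists>\<gamma>. elliptic_trajectory lam S {0..} \<gamma> \<and> \<gamma> 0 = z \<and> (\<gamma> \<longlongrightarrow> p) at_top}"

definition unstable_manifold :: "(complex \<Rightarrow> complex) \<Rightarrow> complex set \<Rightarrow> complex \<Rightarrow> complex set" where
  "unstable_manifold lam S p =
     {z. \<exists>\<gamma>. elliptic_trajectory lam S {..0} \<gamma> \<and> \<gamma> 0 = z \<and> (\<gamma> \<longlongrightarrow> p) at_bot}"

definition forward_orbit :: "(complex \<Rightarrow> complex) \<Rightarrow> complex set \<Rightarrow> complex \<Rightarrow> complex set" where
  "forward_orbit lam S z =
     {\<gamma> t |\<gamma> t. elliptic_trajectory lam S {0..} \<gamma> \<and> \<gamma> 0 = z \<and> 0 \<le> t}"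

definition backward_orbit :: "(complex \<Rightarrow> complex) \<Rightarrow> complex set \<Rightarrow> complex \<Rightarrow> complex set" where
  "backward_orbit lam S z =
     {\<gamma> t |\<gamma> t. elliptic_trajectory lam S {..0} \<gamma> \<and> \<gamma> 0 = z \<and> t \<le> 0}"

text \<open>
  The branch of the stable manifold between \<open>\<mu>\<^sub>s\<close> and the saddle is the forward orbit of
  \<open>\<mu>\<^sub>s\<close>, that of the unstable manifold the backward orbit of \<open>\<mu>\<^sub>u\<close>. Together with the
  saddle and the real segment from \<open>\<mu>\<^sub>s\<close> to \<open>\<mu>\<^sub>u\<close> they form a closed curve; the region is
  taken with its boundary.
\<close>

definition saddle_boundary ::
    "(complex \<Rightarrow> complex) \<Rightarrow> complex set \<Rightarrow> complex \<Rightarrow> real \<Rightarrow> real \<Rightarrow> complex set" where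
  "saddle_boundary lam S p \<mu>\<^sub>s \<mu>\<^sub>u =
     {p} \<union> forward_orbit lam S (of_real \<mu>\<^sub>s) \<union> backward_orbit lam S (of_real \<mu>\<^sub>u)
       \<union> closed_segment (of_real \<mu>\<^sub>s) (of_real \<mu>\<^sub>u)"

definition saddle_region ::
    "(complex \<Rightarrow> complex) \<Rightarrow> complex set \<Rightarrow> complex \<Rightarrow> real \<Rightarrow> real \<Rightarrow> complex set" where
  "saddle_region lam S p \<mu>\<^sub>s \<mu>\<^sub>u =
     saddle_boundary lam S p \<mu>\<^sub>s \<mu>\<^sub>u \<union> inside (saddle_boundary lam S p \<mu>\<^sub>s \<mu>\<^sub>u)"

definition crit_fun :: "(complex \<Rightarrow> complex) \<Rightarrow> (complex \<Rightarrow> complex) \<Rightarrow> complex \<Rightarrow> real" where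
  "crit_fun lam nu \<mu> = Re (- \<i> * cnj (lam \<mu>) * nu \<mu>)"

definition crit_set ::
    "(complex \<Rightarrow> complex) \<Rightarrow> (complex \<Rightarrow> complex) \<Rightarrow> complex set \<Rightarrow> complex set" where
  "crit_set lam nu S = {\<mu>\<in>S. crit_fun lam nu \<mu> = 0}"

text \<open>
  A compact connected smooth 1-manifold in the plane with boundary points \<open>p\<close> and \<open>q\<close> is the
  image of an injective \<open>C\<^sup>\<infinity>\<close> immersion of \<open>[0,1]\<close> with endpoints \<open>p\<close> and \<open>q\<close>.
  Below, \<open>D n\<close> is the \<open>n\<close>-th derivative of the parametrization.
\<close>

definition smooth_arc_between :: "complex set \<Rightarrow> complex \<Rightarrow> complex \<Rightarrow> bool" where
  "smooth_arc_between K p q \<longleftrightarrow>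
     (\<exists>g D. arc g \<and> path_image g = K \<and> pathstart g = p \<and> pathfinish g = q \<and> D 0 = g \<and>
        (\<forall>n. \<forall>t\<in>{0..1}. (D n has_vector_derivative D (Suc n) t) (at t within {0..1})) \<and>
        (\<forall>t\<in>{0..1}. D 1 t \<noteq> 0))"

text \<open>
  The real span of the initial velocities of curves in \<open>K\<close> that start at \<open>p\<close>. One-sided
  velocities are used so that the definition also gives the tangent line at a boundary point.
\<close>

definition tangent_space_at :: "complex set \<Rightarrow> complex \<Rightarrow> complex set" where
  "tangent_space_at K p =
     span {v. \<exists>\<gamma> e. 0 < e \<and> \<gamma> ` {0..e} \<subseteq> K \<and> \<gamma> 0 = p \<and>
              (\<gamma> has_vector_derivative v) (at (0::real) within {0..e})}"

definition hyp_A1 :: "(complex \<Rightarrow> complex) \<Rightarrow> complex set \<Rightarrow> complex \<Rightarrow> bool" where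
  "hyp_A1 lam S p \<longleftrightarrow>
     {\<mu>\<in>S. lam \<mu> = 0} = {p} \<and> zorder lam p = 1 \<and>
     (\<forall>x::real. of_real x \<in> S \<longrightarrow>
        (x > 0 \<longrightarrow> Re (lam (of_real x)) > 0) \<and> (x < 0 \<longrightarrow> Re (lam (of_real x)) < 0))"

definition hyp_A2 :: "(complex \<Rightarrow> complex) \<Rightarrow> complex set \<Rightarrow> complex \<Rightarrow> real \<Rightarrow> bool" where
  "hyp_A2 lam S p \<mu>\<^sub>s \<longleftrightarrow> stable_manifold lam S p \<inter> \<real> = {of_real \<mu>\<^sub>s} \<and> \<mu>\<^sub>s < 0"

definition hyp_A3 :: "(complex \<Rightarrow> complex) \<Rightarrow> complex set \<Rightarrow> complex \<Rightarrow> real \<Rightarrow> bool" where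
  "hyp_A3 lam S p \<mu>\<^sub>u \<longleftrightarrow> unstable_manifold lam S p \<inter> \<real> = {of_real \<mu>\<^sub>u} \<and> \<mu>\<^sub>u > 0"

definition hyp_B1 ::
    "(complex \<Rightarrow> complex) \<Rightarrow> (complex \<Rightarrow> complex) \<Rightarrow> complex set \<Rightarrow> complex \<Rightarrow> complex set \<Rightarrow> bool" where
  "hyp_B1 lam nu S p K \<longleftrightarrow>
     K \<subseteq> crit_set lam nu S \<and> smooth_arc_between K p (cnj p) \<and> 0 \<in> K \<and>
     (\<forall>a b. Complex a b \<in> K \<longrightarrow>
        (\<exists>D. ((\<lambda>(a, b). crit_fun lam nu (Complex a b)) has_derivative D) (at (a, b)) \<and>
             D \<noteq> (\<lambda>_. 0)))"

definition hyp_B2 :: "(complex \<Rightarrow> complex) \<Rightarrow> complex set \<Rightarrow> complex \<Rightarrow> complex set \<Rightarrow> bool" where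
  "hyp_B2 lam S p K \<longleftrightarrow>
     tangent_space_at K p \<inter> tangent_space_at (stable_manifold lam S p) p = {0} \<and>
     tangent_space_at K p \<inter> tangent_space_at (unstable_manifold lam S p) p = {0} \<and>
     (\<forall>z\<in>K - {p, cnj p}. elliptic_field lam z \<notin> tangent_space_at K z)"

text \<open>
  \<open>K\<close> need not be a connected component of the whole set C (which can be a full circle), and it
  leaves the region at 0. So components are those of the part of C in the region, and the only one
  is the part of \<open>K\<close> in the region.
\<close>

definition hyp_B3 ::
    "(complex \<Rightarrow> complex) \<Rightarrow> (complex \<Rightarrow> complex) \<Rightarrow> complex set \<Rightarrow> complex \<Rightarrow> real \<Rightarrow> real
      \<Rightarrow> complex set \<Rightarrow> bool" where
  "hyp_B3 lam nu S p \<mu>\<^sub>s \<mu>\<^sub>u K \<longleftrightarrow>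
     components (crit_set lam nu S \<inter> saddle_region lam S p \<mu>\<^sub>s \<mu>\<^sub>u) =
       {K \<inter> saddle_region lam S p \<mu>\<^sub>s \<mu>\<^sub>u}"

end

theory Submission
  imports Defs
begin

text \<open>
  Write \<open>lam0 = a + i b\<close>, \<open>r = \<bar>lam0\<bar>\<close> and \<open>p = i / lam0\<close>. Both objects in the hypotheses
  are classical planar figures.

  The elliptic flow is \<open>w' = -i cnj lam0 cnj w\<close> with \<open>w = \<mu> - p\<close>. It is real-linear with eigenvalues
  \<open>- r\<close> and \<open>r\<close> on two orthogonal lines, so the invariant manifolds of \<open>p\<close> are the parts in the strip
  of two perpendicular lines through \<open>p\<close>. They meet the real axis at \<open>- 1 / r\<close> and \<open>1 / r\<close>. Thus the
  region bounded by them and the real axis is the right triangle with vertices \<open>- 1 / r\<close>, \<open>1 / r\<close>,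
  \<open>p\<close>, inscribed in the circle \<open>\<bar>\<mu>\<bar> = 1 / r\<close>. This gives the hypotheses A1, A2, A3 for every
  \<open>lam0\<close> with \<open>a > 0\<close>, and the values of \<open>\<mu>\<^sub>s\<close> and \<open>\<mu>\<^sub>u\<close>
  (\<open>hyp_A1_iff\<close>, \<open>hyp_A2_iff\<close>, \<open>hyp_A3_iff\<close>, \<open>saddle_region_eq\<close>).

  The critical function is \<open>2 a (Re \<mu> - b \<bar>\<mu>\<bar>\<^sup>2)\<close>, so the critical set is a circle through \<open>0\<close> (the
  imaginary axis if \<open>b = 0\<close>), traced by \<open>crit_param u = i u / (1 + i b u)\<close> for real \<open>u\<close>, except for the
  point \<open>1 / b\<close> of the circle opposite to \<open>0\<close>. The parameters \<open>u = 1 / a\<close> and \<open>u = - 1 / a\<close> give \<open>p\<close> and its conjugate, and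
  the arc between them through \<open>0\<close> is the part of the critical set in the disc \<open>\<bar>\<mu>\<bar> \<le> 1 / r\<close>.
  Along the curve, the component of the flow normal to it is

  \<open>(1 - a u) (1 - 3 b\<^sup>2 u\<^sup>2) / (1 + b\<^sup>2 u\<^sup>2)\<^sup>2\<close>   (\<open>field_dot_normal\<close>).

  Hence away from \<open>p\<close> contact occurs at \<open>\<bar>u\<bar> = 1 / (sqrt 3 \<bar>b\<bar>)\<close>, and the interior of the arc is free of contact
  points exactly if \<open>a \<ge> sqrt 3 \<bar>b\<bar>\<close>. In the case of equality the contact point has moved
  into \<open>p\<close>: there the arc is tangent to the stable manifold (\<open>b > 0\<close>) or to the unstable one (\<open>b < 0\<close>),
  by \<open>crit_normal_p_dot\<close>. So B2 selects the strict inequality, which is \<open>2 \<bar>b\<bar> < r\<close>.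
  Under this inequality the upper half of the arc lies in the triangle, and as
  the triangle lies in the disc, it contains no other critical points; this is B3.

  For the converse, the curve given by B1 is not assumed to be this arc. A smooth arc in the
  critical set from \<open>p\<close> to its conjugate through \<open>0\<close> must pass through every point of the arc above
  between \<open>0\<close> and \<open>p\<close>, since otherwise it would run through its own endpoint
  (\<open>smooth_arc_contains_crit_param\<close>), and its tangents are those of the critical
  set (\<open>tangent_space_of_smooth_arc\<close>).
\<close>

section \<open>Auxiliary facts about the plane\<close>

lemma one_plus_nonzero: "1 + \<i> * complex_of_real x \<noteq> 0" "1 - \<i> * complex_of_real x \<noteq> 0" "1 + x^2 \<noteq> 0" "1 + x^2 > 0"
  by (auto simp: complex_eq_iff add_nonneg_eq_0_iff add_pos_nonneg)

lemma real_less_iff_square_less: "0 \<le> x \<Longrightarrow> 0 \<le> y \<Longrightarrow> x < y \<longleftrightarrow> x\<^sup>2 < y\<^sup>2" for x y :: real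
  by (auto intro: power_strict_mono power2_less_imp_less)

lemma inner_eq_Re_mult_cnj: "x \<bullet> y = Re (x * cnj y)"
  by (simp add: inner_complex_def)

lemma orthogonal_complex_multiple:
  fixes n x :: complex
  assumes "n \<noteq> 0" "n \<bullet> x = 0"
  obtains s where "x = s *\<^sub>R (\<i> * n)"
proof
  have "cnj n * x = \<i> * of_real (Im (cnj n * x))"
    using assms(2) by (simp add: complex_eq_iff inner_complex_def)
  then have "(n * cnj n) * x = \<i> * of_real (Im (cnj n * x)) * n"
    by (metis mult.assoc mult.commute)
  then have "of_real ((norm n)\<^sup>2) * x = of_real (Im (cnj n * x)) * (\<i> * n)"
    by (simp only: complex_norm_square mult_ac)
  then show "x = (Im (cnj n * x) / (norm n)\<^sup>2) *\<^sub>R (\<i> * n)"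
    using assms(1) by (simp add: scaleR_conv_of_real field_simps)
qed

text \<open>
  In the plane the orthogonal complement of a nonzero vector is a line.
\<close>
lemma orthogonal_complex_span:
  fixes n x y :: complex
  assumes "n \<noteq> 0" "n \<bullet> x = 0" "x \<noteq> 0" "n \<bullet> y = 0"
  shows "y \<in> span {x}"
proof -
  obtain s t where st: "x = s *\<^sub>R (\<i> * n)" "y = t *\<^sub>R (\<i> * n)"
    using orthogonal_complex_multiple assms by metis
  with \<open>x \<noteq> 0\<close> have "y = (t / s) *\<^sub>R x" by auto
  then show ?thesis by (metis span_base span_scale singletonI)
qed

lemma frontier_Un_inside:
  fixes H :: "'a :: {real_normed_vector, perfect_space} set"
  assumes "convex H" "bounded H" "closed H"
  shows "frontier H \<union> inside (frontier H) = H"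
proof -
  have "frontier H \<union> inside (frontier H) = frontier H \<union> interior H"
    using assms by (simp add: inside_frontier_eq_interior)
  also have "\<dots> = H"
    using assms interior_subset[of H] by (auto simp: frontier_def)
  finally show ?thesis .
qed

text \<open>
  The results below hold for every convex set that contains the disc of radius \<open>1 / \<bar>lam0\<bar>\<close>; the next
  two lemmas make them applicable to all sufficiently large strips.
\<close>
lemma strip_convex: "convex (strip C1 C2 C3 C4)"
proof -
  have "strip C1 C2 C3 C4 = cbox (Complex (- C1) (- C3)) (Complex C2 C4)"
    by (auto simp: strip_def in_cbox_complex_iff)
  then show ?thesis by (simp add: convex_box)
qed

lemma cball_subset_strip:
  assumes "C1 \<ge> M" "C2 \<ge> M" "C3 \<ge> M" "C4 \<ge> M"
  shows "cball 0 M \<subseteq> strip C1 C2 C3 C4"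
proof
  fix z :: complex assume "z \<in> cball 0 M"
  then have "\<bar>Re z\<bar> \<le> M" "\<bar>Im z\<bar> \<le> M"
    using abs_Re_le_cmod[of z] abs_Im_le_cmod[of z] by auto
  then show "z \<in> strip C1 C2 C3 C4"
    using assms by (auto simp: strip_def)
qed

section \<open>Tangent spaces of level sets\<close>

text \<open>
  Differentiating \<open>h \<circ> \<gamma> = 0\<close> at \<open>0\<close> shows that velocities lie in the kernel of the differential, and
  the kernel is a subspace, so it also contains their span.
\<close>
lemma tangent_space_at_subset_kernel:
  assumes K: "K \<subseteq> {z. h z = (0::real)}" and h: "(h has_derivative h') (at p)"
  shows "tangent_space_at K p \<subseteq> {v. h' v = 0}"
  unfolding tangent_space_at_def
proof (rule span_minimal)
  have lin: "linear h'" using h by (rule has_derivative_linear)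
  show "subspace {v. h' v = 0}"
    by (rule linear_subspace_kernel[OF lin])
  show "{v. \<exists>\<gamma> e. 0 < e \<and> \<gamma> ` {0..e} \<subseteq> K \<and> \<gamma> 0 = p \<and>
              (\<gamma> has_vector_derivative v) (at (0::real) within {0..e})} \<subseteq> {v. h' v = 0}"
  proof clarify
    fix v \<gamma> e
    assume e: "0 < (e::real)" and im: "\<gamma> ` {0..e} \<subseteq> K" and p: "p = \<gamma> 0"
      and der: "(\<gamma> has_vector_derivative v) (at 0 within {0..e})"
    have d: "(\<gamma> has_derivative (\<lambda>t. t *\<^sub>R v)) (at 0 within {0..e})"
      using der by (simp add: has_vector_derivative_def)
    have "((\<lambda>t. h (\<gamma> t)) has_derivative (\<lambda>t. h' (t *\<^sub>R v))) (at 0 within {0..e})"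
      using has_derivative_compose[OF d] h p by blast
    then have "((\<lambda>t. h (\<gamma> t)) has_vector_derivative h' v) (at 0 within {0..e})"
      by (simp add: has_vector_derivative_def linear_scale[OF lin])
    moreover have "h (\<gamma> t) = 0" if "t \<in> {0..e}" for t
      using im K that by blast
    then have "((\<lambda>t. h (\<gamma> t)) has_vector_derivative 0) (at 0 within {0..e})"
      using e by (intro has_vector_derivative_transform[OF _ _ has_vector_derivative_const[of 0]]) auto
    ultimately show "h' v = 0"
      using e by (intro vector_derivative_unique_within[of 0 "{0..e}"]) (auto simp: trivial_limit_within islimpt_Icc)
  qed
qed

lemma velocity_in_tangent_space:
  assumes "0 < e" "\<gamma> ` {0..e} \<subseteq> K" "\<gamma> 0 = p"
    "(\<gamma> has_vector_derivative v) (at (0::real) within {0..e})"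
  shows "v \<in> tangent_space_at K p"
  unfolding tangent_space_at_def using assms by (blast intro: span_base)

section \<open>Invariant manifolds of a linear saddle\<close>

text \<open>
  The product of a solution with \<open>exp (- k t)\<close> has derivative \<open>0\<close>, and on a convex set of times this
  makes it constant, also with one-sided derivatives at the ends.
\<close>
lemma linear_ode_solution:
  fixes x :: "real \<Rightarrow> real"
  assumes T: "convex T" "0 \<in> T" "t \<in> T"
    and x: "\<And>t. t \<in> T \<Longrightarrow> (x has_vector_derivative k * x t) (at t within T)"
  shows "x t = exp (k * t) * x 0"
proof -
  have "((\<lambda>t. exp (- k * t) * x t) has_vector_derivative 0) (at t within T)" if "t \<in> T" for t
    using x[OF that] unfolding has_real_derivative_iff_has_vector_derivative[symmetric]
    by (auto intro!: derivative_eq_intros simp: algebra_simps)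
  then obtain c where c: "\<And>t. t \<in> T \<Longrightarrow> exp (- k * t) * x t = c"
    using has_vector_derivative_zero_constant[OF \<open>convex T\<close>, of "\<lambda>t. exp (- k * t) * x t"] by metis
  from c[OF T(3)] c[OF T(2)] have "exp (- k * t) * x t = x 0" by simp
  then show ?thesis by (auto simp: exp_minus field_simps)
qed

text \<open>
  A complex affine \<open>lam\<close> with root \<open>p\<close>. The map \<open>w \<mapsto> -i cnj l cnj w\<close> is the composition of a
  reflection with a dilation by \<open>\<bar>l\<bar>\<close>: if \<open>v\<close> is an eigenvector for \<open>-\<bar>l\<bar>\<close>, then \<open>i v\<close> is one for
  \<open>\<bar>l\<bar>\<close>. The vector \<open>v\<close> is kept as a parameter, because a formula for it in terms of \<open>l\<close>
  alone needs a complex square root.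
\<close>
locale saddle_field =
  fixes l p v :: complex and lam :: "complex \<Rightarrow> complex"
  assumes l: "l \<noteq> 0" and v: "v \<noteq> 0"
    and lam: "\<And>z. lam z = l * (z - p)"
    and stable: "- \<i> * cnj l * cnj v = - of_real (cmod l) * v"
begin

lemma field_stable: "elliptic_field lam z \<bullet> v = - cmod l * ((z - p) \<bullet> v)"
proof -
  have "elliptic_field lam z \<bullet> v = Re (cnj (elliptic_field lam z) * v)"
    by (simp add: inner_complex_def)
  also have "cnj (elliptic_field lam z) * v = (z - p) * cnj (- \<i> * cnj l * cnj v)"
    by (simp add: elliptic_field_def lam)
  also have "Re \<dots> = - cmod l * ((z - p) \<bullet> v)"
    unfolding stable by (simp add: inner_complex_def algebra_simps)
  finally show ?thesis .
qed

lemma field_unstable: "elliptic_field lam z \<bullet> (\<i> * v) = cmod l * ((z - p) \<bullet> (\<i> * v))"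
proof -
  have "elliptic_field lam z \<bullet> (\<i> * v) = Re (\<i> * (cnj (elliptic_field lam z) * v))"
    by (simp add: inner_complex_def)
  also have "cnj (elliptic_field lam z) * v = (z - p) * cnj (- \<i> * cnj l * cnj v)"
    by (simp add: elliptic_field_def lam)
  also have "Re (\<i> * \<dots>) = cmod l * ((z - p) \<bullet> (\<i> * v))"
    unfolding stable by (simp add: inner_complex_def algebra_simps)
  finally show ?thesis .
qed

lemma eq_if_coordinates_eq:
  assumes "x \<bullet> v = y \<bullet> v" "x \<bullet> (\<i> * v) = y \<bullet> (\<i> * v)"
  shows "x = y"
proof -
  have "cnj (x - y) * v = Complex ((x - y) \<bullet> v) ((x - y) \<bullet> (\<i> * v) * -1)"
    by (rule complex_eqI) (simp_all add: inner_complex_def algebra_simps)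
  then have "cnj (x - y) * v = 0"
    using assms by (simp add: inner_diff_left Complex_eq_0)
  then show ?thesis using v by simp
qed

text \<open>
  In the orthogonal basis \<open>v\<close>, \<open>i v\<close> the flow decouples into two scalar linear equations.
\<close>
lemma trajectory_coordinates:
  assumes "elliptic_trajectory lam S T \<gamma>" "convex T" "0 \<in> T" "t \<in> T"
  shows "(\<gamma> t - p) \<bullet> v = exp (- cmod l * t) * ((\<gamma> 0 - p) \<bullet> v)"
    and "(\<gamma> t - p) \<bullet> (\<i> * v) = exp (cmod l * t) * ((\<gamma> 0 - p) \<bullet> (\<i> * v))"
proof -
  have der: "((\<lambda>t. (\<gamma> t - p) \<bullet> w) has_vector_derivative elliptic_field lam (\<gamma> t) \<bullet> w) (at t within T)"
    if "t \<in> T" for t w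
  proof -
    have "(\<gamma> has_vector_derivative elliptic_field lam (\<gamma> t)) (at t within T)"
      using assms(1) that by (auto simp: elliptic_trajectory_def)
    then have "((\<lambda>t. \<gamma> t - p) has_vector_derivative elliptic_field lam (\<gamma> t)) (at t within T)"
      by (auto intro!: derivative_eq_intros)
    then show ?thesis
      using bounded_linear.has_vector_derivative[OF bounded_linear_inner_left] by blast
  qed
  show "(\<gamma> t - p) \<bullet> v = exp (- cmod l * t) * ((\<gamma> 0 - p) \<bullet> v)"
    by (rule linear_ode_solution[where T=T and x="\<lambda>t. (\<gamma> t - p) \<bullet> v"])
      (use assms der[of _ v] in \<open>auto simp only: field_stable\<close>)
  show "(\<gamma> t - p) \<bullet> (\<i> * v) = exp (cmod l * t) * ((\<gamma> 0 - p) \<bullet> (\<i> * v))"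
    by (rule linear_ode_solution[where T=T and x="\<lambda>t. (\<gamma> t - p) \<bullet> (\<i> * v)"])
      (use assms der[of _ "\<i> * v"] in \<open>auto simp only: field_unstable\<close>)
qed

lemma stable_trajectory:
  assumes "convex S" "p \<in> S" "z \<in> S" "(z - p) \<bullet> (\<i> * v) = 0"
  defines "\<gamma> \<equiv> \<lambda>t. p + exp (- cmod l * t) *\<^sub>R (z - p)"
  shows "elliptic_trajectory lam S {0..} \<gamma>" "\<gamma> 0 = z" "(\<gamma> \<longlongrightarrow> p) at_top"
proof -
  show "\<gamma> 0 = z" by (simp add: \<gamma>_def)
  have "((\<lambda>t. exp (- cmod l * t)) \<longlongrightarrow> 0) at_top"
    using l by real_asymp
  then have "(\<gamma> \<longlongrightarrow> p + 0 *\<^sub>R (z - p)) at_top"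
    unfolding \<gamma>_def by (intro tendsto_intros)
  then show "(\<gamma> \<longlongrightarrow> p) at_top" by simp
  have S: "\<gamma> t \<in> S" if "0 \<le> t" for t
  proof -
    have "\<gamma> t = (1 - exp (- cmod l * t)) *\<^sub>R p + exp (- cmod l * t) *\<^sub>R z"
      by (simp add: \<gamma>_def algebra_simps)
    then show ?thesis
      using assms that by (auto intro!: convexD)
  qed
  have field: "elliptic_field lam (\<gamma> t) = - cmod l *\<^sub>R (\<gamma> t - p)" for t
    by (rule eq_if_coordinates_eq) 
      (use assms in \<open>simp_all only: field_stable field_unstable inner_scaleR_left\<close>, simp add: \<gamma>_def assms)
  have "(\<gamma> has_vector_derivative elliptic_field lam (\<gamma> t)) (at t within {0..})" for t
    unfolding field unfolding \<gamma>_def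
    by (auto intro!: derivative_eq_intros simp: has_vector_derivative_def)
  then show "elliptic_trajectory lam S {0..} \<gamma>"
    using S by (auto simp: elliptic_trajectory_def)
qed

text \<open>
  The coordinate along \<open>i v\<close> grows exponentially, so a trajectory that converges to \<open>p\<close> has to start
  with this coordinate equal to \<open>0\<close>. Convexity of \<open>S\<close> keeps the straight trajectories to \<open>p\<close> inside \<open>S\<close>.
\<close>
lemma stable_manifold_eq:
  assumes "convex S" "p \<in> S"
  shows "stable_manifold lam S p = {z \<in> S. (z - p) \<bullet> (\<i> * v) = 0}"
proof (intro equalityI subsetI)
  fix z assume "z \<in> stable_manifold lam S p"
  then obtain \<gamma> where \<gamma>: "elliptic_trajectory lam S {0..} \<gamma>" "\<gamma> 0 = z" "(\<gamma> \<longlongrightarrow> p) at_top"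
    by (auto simp: stable_manifold_def)
  have "((\<lambda>t. exp (- cmod l * t) * ((\<gamma> t - p) \<bullet> (\<i> * v))) \<longlongrightarrow> 0 * ((p - p) \<bullet> (\<i> * v))) at_top"
    using l by (intro tendsto_intros \<gamma>) real_asymp
  moreover have "\<forall>\<^sub>F t in at_top. exp (- cmod l * t) * ((\<gamma> t - p) \<bullet> (\<i> * v)) = (z - p) \<bullet> (\<i> * v)"
    using eventually_ge_at_top[of 0]
  proof eventually_elim
    case (elim t)
    show ?case
      using trajectory_coordinates(2)[OF \<gamma>(1), of t] elim \<gamma>(2) by (simp add: exp_minus)
  qed
  ultimately have "((\<lambda>t::real. (z - p) \<bullet> (\<i> * v)) \<longlongrightarrow> 0 * ((p - p) \<bullet> (\<i> * v))) at_top"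
    by (rule Lim_transform_eventually)
  moreover have "z \<in> S"
    using \<gamma> by (auto simp: elliptic_trajectory_def)
  ultimately show "z \<in> {z \<in> S. (z - p) \<bullet> (\<i> * v) = 0}"
    by (simp add: tendsto_const_iff)
next
  fix z assume "z \<in> {z \<in> S. (z - p) \<bullet> (\<i> * v) = 0}"
  then show "z \<in> stable_manifold lam S p"
    using stable_trajectory[OF assms, of z] by (auto simp: stable_manifold_def)
qed

text \<open>
  The orbit approaches the saddle without reaching it, which is why \<open>p\<close> has to be added.
\<close>
lemma forward_orbit_eq:
  assumes S: "convex S" "p \<in> S" "z \<in> S" and z: "(z - p) \<bullet> (\<i> * v) = 0"
  shows "insert p (forward_orbit lam S z) = closed_segment p z"
proof (intro equalityI subsetI)
  fix w assume "w \<in> insert p (forward_orbit lam S z)"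
  then consider "w = p" | \<gamma> t where "w = \<gamma> t" "elliptic_trajectory lam S {0..} \<gamma>" "\<gamma> 0 = z" "0 \<le> t"
    by (auto simp: forward_orbit_def)
  then show "w \<in> closed_segment p z"
  proof cases
    case 2
    have "w - p = exp (- cmod l * t) *\<^sub>R (z - p)"
      by (rule eq_if_coordinates_eq) (use trajectory_coordinates[OF 2(2), of t] 2 z in auto)
    then have "w = (1 - exp (- cmod l * t)) *\<^sub>R p + exp (- cmod l * t) *\<^sub>R z"
      by (simp add: algebra_simps)
    then show ?thesis
      unfolding in_segment using 2 by (intro exI[of _ "exp (- cmod l * t)"]) simp
  qed simp
next
  fix w assume "w \<in> closed_segment p z"
  then obtain u where u: "0 \<le> u" "u \<le> 1" "w = p + u *\<^sub>R (z - p)"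
    by (auto simp: in_segment algebra_simps)
  show "w \<in> insert p (forward_orbit lam S z)"
  proof (cases "u = 0")
    case False
    define t where "t = - ln u / cmod l"
    have t: "0 \<le> t" "exp (- cmod l * t) = u"
      using u False l by (auto simp: t_def divide_simps)
    define \<gamma> where "\<gamma> = (\<lambda>t. p + exp (- cmod l * t) *\<^sub>R (z - p))"
    have "elliptic_trajectory lam S {0..} \<gamma>" "\<gamma> 0 = z"
      using stable_trajectory[OF S z] unfolding \<gamma>_def by blast+
    moreover have "w = \<gamma> t"
      using u(3) t(2) by (simp add: \<gamma>_def)
    ultimately show ?thesis
      using t(1) unfolding forward_orbit_def by blast
  qed (use u in simp)
qed

end

text \<open>
  Time reversal replaces \<open>lam\<close> by \<open>- lam\<close>, so unstable manifolds and backward orbits need no separate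
  analysis.
\<close>
lemma elliptic_trajectory_reverse:
  "elliptic_trajectory lam S T \<gamma> \<longleftrightarrow>
    elliptic_trajectory (\<lambda>z. - lam z) S (uminus ` T) (\<lambda>t. \<gamma> (- t))"
proof -
  have reverse: "elliptic_trajectory (\<lambda>z. - lam z) S (uminus ` T) (\<lambda>t. \<gamma> (- t))"
    if *: "elliptic_trajectory lam S T \<gamma>" for lam S T \<gamma>
    unfolding elliptic_trajectory_def
  proof (intro ballI conjI)
    fix t assume "t \<in> uminus ` T"
    then have t: "- t \<in> T" by auto
    then show "\<gamma> (- t) \<in> S"
      using * by (auto simp: elliptic_trajectory_def)
    have "(\<gamma> has_vector_derivative elliptic_field lam (\<gamma> (- t))) (at (- t) within uminus ` uminus ` T)"
      using * t by (auto simp: elliptic_trajectory_def image_image)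
    then have "(\<gamma> \<circ> uminus has_vector_derivative - 1 *\<^sub>R elliptic_field lam (\<gamma> (- t))) (at t within uminus ` T)"
      by (intro vector_diff_chain_within) (auto intro!: derivative_eq_intros)
    then show "((\<lambda>t. \<gamma> (- t)) has_vector_derivative elliptic_field (\<lambda>z. - lam z) (\<gamma> (- t))) (at t within uminus ` T)"
      by (simp add: o_def elliptic_field_def)
  qed
  show ?thesis
    using reverse[of lam S T \<gamma>] reverse[of "\<lambda>z. - lam z" S "uminus ` T" "\<lambda>t. \<gamma> (- t)"]
    by (auto simp: image_image)
qed

lemma unstable_manifold_reverse: "unstable_manifold lam S p = stable_manifold (\<lambda>z. - lam z) S p"
proof -
  have "(\<exists>\<gamma>. elliptic_trajectory lam S {..0} \<gamma> \<and> \<gamma> 0 = z \<and> (\<gamma> \<longlongrightarrow> p) at_bot) \<longleftrightarrow>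
        (\<exists>\<gamma>. elliptic_trajectory (\<lambda>z. - lam z) S {0..} \<gamma> \<and> \<gamma> 0 = z \<and> (\<gamma> \<longlongrightarrow> p) at_top)" for z
  proof safe
    fix \<gamma> assume "elliptic_trajectory lam S {..0} \<gamma>" "(\<gamma> \<longlongrightarrow> p) at_bot"
    then show "\<exists>\<gamma>'. elliptic_trajectory (\<lambda>z. - lam z) S {0..} \<gamma>' \<and> \<gamma>' 0 = \<gamma> 0 \<and> (\<gamma>' \<longlongrightarrow> p) at_top"
      using elliptic_trajectory_reverse[of lam S "{..0}" \<gamma>]
      by (intro exI[of _ "\<lambda>t. \<gamma> (- t)"]) (auto simp: filterlim_at_bot_mirror)
  next
    fix \<gamma> assume "elliptic_trajectory (\<lambda>z. - lam z) S {0..} \<gamma>" "(\<gamma> \<longlongrightarrow> p) at_top"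
    then show "\<exists>\<gamma>'. elliptic_trajectory lam S {..0} \<gamma>' \<and> \<gamma>' 0 = \<gamma> 0 \<and> (\<gamma>' \<longlongrightarrow> p) at_bot"
      using elliptic_trajectory_reverse[of "\<lambda>z. - lam z" S "{0..}" \<gamma>]
      by (intro exI[of _ "\<lambda>t. \<gamma> (- t)"]) (auto simp: filterlim_at_bot_mirror)
  qed
  then show ?thesis by (simp add: stable_manifold_def unstable_manifold_def)
qed

lemma backward_orbit_reverse: "backward_orbit lam S z = forward_orbit (\<lambda>z. - lam z) S z"
proof (intro equalityI subsetI)
  fix w assume "w \<in> backward_orbit lam S z"
  then obtain \<gamma> t where "elliptic_trajectory lam S {..0} \<gamma>" "\<gamma> 0 = z" "t \<le> 0" "w = \<gamma> t"
    by (auto simp: backward_orbit_def)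
  then show "w \<in> forward_orbit (\<lambda>z. - lam z) S z"
    using elliptic_trajectory_reverse[of lam S "{..0}" \<gamma>] unfolding forward_orbit_def
    by (intro CollectI exI[of _ "\<lambda>t. \<gamma> (- t)"] exI[of _ "- t"]) auto
next
  fix w assume "w \<in> forward_orbit (\<lambda>z. - lam z) S z"
  then obtain \<gamma> t where "elliptic_trajectory (\<lambda>z. - lam z) S {0..} \<gamma>" "\<gamma> 0 = z" "0 \<le> t" "w = \<gamma> t"
    by (auto simp: forward_orbit_def)
  then show "w \<in> backward_orbit lam S z"
    using elliptic_trajectory_reverse[of "\<lambda>z. - lam z" S "{0..}" \<gamma>] unfolding backward_orbit_def
    by (intro CollectI exI[of _ "\<lambda>t. \<gamma> (- t)"] exI[of _ "- t"]) auto
qed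

section \<open>The saddle of the linear eigenvalue\<close>

locale linear_eigenvalue =
  fixes lam0 :: complex
  assumes Re_pos: "Re lam0 > 0"
begin

abbreviation "a \<equiv> Re lam0"
abbreviation "b \<equiv> Im lam0"
abbreviation "r \<equiv> cmod lam0"
abbreviation "p \<equiv> \<i> / lam0"
abbreviation lam :: "complex \<Rightarrow> complex" where "lam \<equiv> \<lambda>z. lam0 * z - \<i>"
abbreviation nu :: "complex \<Rightarrow> complex" where "nu \<equiv> \<lambda>z. cnj lam0 * z + \<i>"

text \<open>
  Directions of the stable and the unstable line: up to the factor \<open>r\<^sup>2\<close> these are the vectors from
  \<open>- 1 / r\<close> and from \<open>1 / r\<close> to \<open>p\<close>. They are orthogonal, as the angle at \<open>p\<close> subtends a diameter
  of the circle \<open>\<bar>\<mu>\<bar> = 1 / r\<close>.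
\<close>
definition v\<^sub>s :: complex where "v\<^sub>s = \<i> * cnj lam0 + of_real r"
definition v\<^sub>u :: complex where "v\<^sub>u = \<i> * cnj lam0 - of_real r"

lemma Re_Im_dirs [simp]: "Re v\<^sub>s = b + r" "Im v\<^sub>s = a" "Re v\<^sub>u = b - r" "Im v\<^sub>u = a"
  by (simp_all add: v\<^sub>s_def v\<^sub>u_def)

lemma lam0_nz: "lam0 \<noteq> 0"
  using Re_pos by auto

lemma r_pos: "r > 0"
  using lam0_nz by simp

lemma r_sq: "r^2 = a^2 + b^2"
  by (rule cmod_power2)

lemma abs_b_less_r: "\<bar>b\<bar> < r"
proof (rule power2_less_imp_less)
  have "0 < a^2" using Re_pos by simp
  then show "\<bar>b\<bar>\<^sup>2 < r\<^sup>2" unfolding r_sq power2_abs by linarith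
qed simp

lemma p_eq: "p = Complex (b / r^2) (a / r^2)"
  unfolding r_sq by (simp add: complex_eq_iff Re_divide Im_divide)

lemma Re_p: "Re p = b / r^2" and Im_p: "Im p = a / r^2"
  by (simp_all only: p_eq complex.sel)

text \<open>
  Rotation by a right angle exchanges the two lines, so each line can be described as the orthogonal
  complement of the direction of the other.
\<close>
lemma i_dirs: "\<i> * v\<^sub>s = ((b + r) / a) *\<^sub>R v\<^sub>u" "\<i> * v\<^sub>u = ((b - r) / a) *\<^sub>R v\<^sub>s"
proof -
  have "a * a = (r - b) * (r + b)"
    using r_sq by (simp add: algebra_simps power2_eq_square)
  then show "\<i> * v\<^sub>s = ((b + r) / a) *\<^sub>R v\<^sub>u" "\<i> * v\<^sub>u = ((b - r) / a) *\<^sub>R v\<^sub>s"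
    using Re_pos by (auto simp: complex_eq_iff field_simps)
qed

lemma dirs_nonzero: "v\<^sub>s \<noteq> 0" "v\<^sub>u \<noteq> 0"
  using Re_pos by (auto simp: complex_eq_iff)

lemma inner_i_dirs: "z \<bullet> (\<i> * v\<^sub>s) = 0 \<longleftrightarrow> z \<bullet> v\<^sub>u = 0" "z \<bullet> (\<i> * v\<^sub>u) = 0 \<longleftrightarrow> z \<bullet> v\<^sub>s = 0"
proof -
  have "b + r \<noteq> 0" "b - r \<noteq> 0" using abs_b_less_r by auto
  then show "z \<bullet> (\<i> * v\<^sub>s) = 0 \<longleftrightarrow> z \<bullet> v\<^sub>u = 0" "z \<bullet> (\<i> * v\<^sub>u) = 0 \<longleftrightarrow> z \<bullet> v\<^sub>s = 0"
    unfolding i_dirs inner_scaleR_right using Re_pos by simp_all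
qed

lemma eigen_dirs:
  "- \<i> * cnj lam0 * cnj v\<^sub>s = - of_real r * v\<^sub>s"
  "- \<i> * cnj (- lam0) * cnj v\<^sub>u = - of_real r * v\<^sub>u"
proof -
  have r: "of_real r * of_real r = lam0 * cnj lam0"
    by (simp add: complex_norm_square[symmetric] power2_eq_square)
  have "- \<i> * cnj lam0 * cnj v\<^sub>s = - (lam0 * cnj lam0) - of_real r * (\<i> * cnj lam0)"
    by (simp add: v\<^sub>s_def algebra_simps)
  also have "\<dots> = - of_real r * v\<^sub>s"
    unfolding v\<^sub>s_def r[symmetric] by (simp add: algebra_simps)
  finally show "- \<i> * cnj lam0 * cnj v\<^sub>s = - of_real r * v\<^sub>s" .
  have "- \<i> * cnj (- lam0) * cnj v\<^sub>u = lam0 * cnj lam0 - of_real r * (\<i> * cnj lam0)"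
    by (simp add: v\<^sub>u_def algebra_simps)
  also have "\<dots> = - of_real r * v\<^sub>u"
    unfolding v\<^sub>u_def r[symmetric] by (simp add: algebra_simps)
  finally show "- \<i> * cnj (- lam0) * cnj v\<^sub>u = - of_real r * v\<^sub>u" .
qed

sublocale stable: saddle_field lam0 p v\<^sub>s lam
proof
  show "v\<^sub>s \<noteq> 0" by (rule dirs_nonzero)
  show "lam z = lam0 * (z - p)" for z using lam0_nz by (simp add: field_simps)
  show "- \<i> * cnj lam0 * cnj v\<^sub>s = - of_real r * v\<^sub>s"
    by (rule eigen_dirs)
qed (rule lam0_nz)

sublocale unstable: saddle_field "- lam0" p v\<^sub>u "\<lambda>z. - lam z"
proof
  show "v\<^sub>u \<noteq> 0" by (rule dirs_nonzero)
  show "- lam z = - lam0 * (z - p)" for z using lam0_nz by (simp add: field_simps)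
  show "- \<i> * cnj (- lam0) * cnj v\<^sub>u = - of_real (cmod (- lam0)) * v\<^sub>u"
    unfolding norm_minus_cancel by (rule eigen_dirs)
qed (use lam0_nz in simp)

lemma stable_manifold_line:
  assumes "convex S" "p \<in> S"
  shows "stable_manifold lam S p = {z \<in> S. (z - p) \<bullet> v\<^sub>u = 0}"
  using stable.stable_manifold_eq[OF assms] unfolding inner_i_dirs .

lemma unstable_manifold_line:
  assumes "convex S" "p \<in> S"
  shows "unstable_manifold lam S p = {z \<in> S. (z - p) \<bullet> v\<^sub>s = 0}"
  using unstable.stable_manifold_eq[OF assms] unfolding inner_i_dirs unstable_manifold_reverse .

lemma p_inner: "p \<bullet> v\<^sub>s = (r + b) / r" "p \<bullet> v\<^sub>u = (r - b) / r"
proof -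
  have "p \<bullet> v\<^sub>s = ((a^2 + b^2) + b * r) / r^2" "p \<bullet> v\<^sub>u = ((a^2 + b^2) - b * r) / r^2"
    unfolding inner_complex_def Re_p Im_p
    by (simp_all add: algebra_simps add_divide_distrib diff_divide_distrib power2_eq_square)
  moreover have "(r^2 + b * r) / r^2 = (r + b) / r" "(r^2 - b * r) / r^2 = (r - b) / r"
    using r_pos by (simp_all add: field_simps power2_eq_square)
  ultimately show "p \<bullet> v\<^sub>s = (r + b) / r" "p \<bullet> v\<^sub>u = (r - b) / r"
    unfolding r_sq[symmetric] by simp_all
qed

lemma real_on_stable_line: "(of_real x - p) \<bullet> v\<^sub>u = 0 \<longleftrightarrow> x = - (1 / r)"
proof -
  have "(of_real x - p) \<bullet> v\<^sub>u = (b - r) * (x + 1 / r)"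
    unfolding inner_diff_left p_inner using r_pos by (simp add: inner_complex_def field_simps)
  then show ?thesis using abs_b_less_r by auto
qed

lemma real_on_unstable_line: "(of_real x - p) \<bullet> v\<^sub>s = 0 \<longleftrightarrow> x = 1 / r"
proof -
  have "(of_real x - p) \<bullet> v\<^sub>s = (b + r) * (x - 1 / r)"
    unfolding inner_diff_left p_inner using r_pos by (simp add: inner_complex_def field_simps)
  then show ?thesis using abs_b_less_r by auto
qed

lemma norm_p: "norm p = 1 / r"
  by (simp add: norm_divide)

text \<open>
  The two orbits are sides of the triangle, so the boundary curve is the frontier of the triangle and
  its inside is the interior.
\<close>
lemma saddle_region_eq:
  assumes "convex S" "cball 0 (1 / r) \<subseteq> S"
  shows "saddle_region lam S p (- (1 / r)) (1 / r)
       = convex hull {p, of_real (- (1 / r)), of_real (1 / r)}" (is "_ = convex hull {p, ?s, ?u}")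
proof -
  have S: "p \<in> S" "?s \<in> S" "?u \<in> S"
    using assms(2) r_pos norm_p by (auto intro!: subsetD[OF assms(2)] simp: norm_divide)
  have "insert p (forward_orbit lam S ?s) = closed_segment p ?s"
    using real_on_stable_line[of "- (1 / r)"] S assms(1)
    by (intro stable.forward_orbit_eq) (simp_all only: inner_i_dirs)
  moreover have "insert p (backward_orbit lam S ?u) = closed_segment p ?u"
    using real_on_unstable_line[of "1 / r"] S assms(1)
    unfolding backward_orbit_reverse by (intro unstable.forward_orbit_eq) (simp_all only: inner_i_dirs)
  ultimately have "saddle_boundary lam S p (- (1 / r)) (1 / r)
      = closed_segment p ?s \<union> closed_segment ?s ?u \<union> closed_segment ?u p"
    unfolding saddle_boundary_def closed_segment_commute[of ?u p] by blast
  also have "\<dots> = frontier (convex hull {p, ?s, ?u})"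
    by (rule frontier_of_triangle[symmetric]) simp
  finally have bd: "saddle_boundary lam S p (- (1 / r)) (1 / r) = frontier (convex hull {p, ?s, ?u})" .
  show ?thesis
    unfolding saddle_region_def bd
    by (intro frontier_Un_inside) (simp_all add: bounded_convex_hull compact_imp_closed compact_convex_hull)
qed

lemma hyp_A1_iff:
  assumes "cball 0 (1 / r) \<subseteq> S"
  shows "hyp_A1 lam S q \<longleftrightarrow> q = p"
proof -
  have "p \<in> S"
    using assms norm_p by (auto intro!: subsetD[OF assms])
  then have "{\<mu>\<in>S. lam \<mu> = 0} = {p}"
    using lam0_nz by (auto simp: field_simps)
  moreover have "zorder lam p = 1"
    by (rule zorder_eqI[of UNIV _ "\<lambda>_. lam0"]) (use lam0_nz in \<open>auto simp: field_simps\<close>)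
  ultimately show ?thesis
    using Re_pos by (auto simp: hyp_A1_def zero_less_mult_iff mult_less_0_iff)
qed

lemma hyp_A2_iff:
  assumes "convex S" "cball 0 (1 / r) \<subseteq> S"
  shows "hyp_A2 lam S p s \<longleftrightarrow> s = - (1 / r)"
proof -
  have S: "p \<in> S" "of_real (- (1 / r)) \<in> S"
    using assms(2) r_pos norm_p by (auto intro!: subsetD[OF assms(2)] simp: norm_divide)
  have "stable_manifold lam S p \<inter> \<real> = {of_real (- (1 / r))}"
    unfolding stable_manifold_line[OF assms(1) S(1)]
    using S(2) real_on_stable_line by (auto elim!: Reals_cases simp del: of_real_minus of_real_divide)
  then show ?thesis
    using r_pos by (auto simp: hyp_A2_def simp flip: of_real_minus of_real_divide)
qed

lemma hyp_A3_iff: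
  assumes "convex S" "cball 0 (1 / r) \<subseteq> S"
  shows "hyp_A3 lam S p u \<longleftrightarrow> u = 1 / r"
proof -
  have S: "p \<in> S" "of_real (1 / r) \<in> S"
    using assms(2) r_pos norm_p by (auto intro!: subsetD[OF assms(2)] simp: norm_divide)
  have "unstable_manifold lam S p \<inter> \<real> = {of_real (1 / r)}"
    unfolding unstable_manifold_line[OF assms(1) S(1)]
    using S(2) real_on_unstable_line by (auto elim!: Reals_cases simp del: of_real_divide)
  then show ?thesis
    using r_pos by (auto simp: hyp_A3_def simp flip: of_real_divide)
qed

section \<open>The critical set\<close>

lemma crit_fun_eq: "crit_fun lam nu z = 2 * a * (Re z - b * (norm z)\<^sup>2)"
  unfolding cmod_power2 by (simp add: crit_fun_def algebra_simps power2_eq_square)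

lemma crit_fun_eq_0_iff: "crit_fun lam nu z = 0 \<longleftrightarrow> Re z = b * (norm z)\<^sup>2"
  using Re_pos by (auto simp: crit_fun_eq)

text \<open>
  The gradient of the critical function divided by \<open>2 a\<close>.
\<close>
definition crit_normal :: "complex \<Rightarrow> complex" where
  "crit_normal z = 1 - 2 * of_real b * z"

lemma crit_fun_has_derivative:
  "(crit_fun lam nu has_derivative (\<lambda>w. 2 * a * (crit_normal z \<bullet> w))) (at z)"
proof -
  have "((\<lambda>z. 2 * a * (Re z - b * (Re z ^ 2 + Im z ^ 2))) has_derivative
      (\<lambda>w. 2 * a * (Re w - b * (2 * Re z * Re w + 2 * Im z * Im w)))) (at z)"
    by (auto intro!: derivative_eq_intros simp: algebra_simps)
  moreover have "crit_fun lam nu = (\<lambda>z. 2 * a * (Re z - b * (Re z ^ 2 + Im z ^ 2)))"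
    unfolding crit_fun_eq[abs_def] cmod_power2 ..
  moreover have "(\<lambda>w. 2 * a * (Re w - b * (2 * Re z * Re w + 2 * Im z * Im w)))
       = (\<lambda>w. 2 * a * (crit_normal z \<bullet> w))"
    by (auto simp: crit_normal_def inner_complex_def algebra_simps)
  ultimately show ?thesis by simp
qed

lemma tangent_space_orthogonal_normal:
  assumes "K \<subseteq> crit_set lam nu S"
  shows "tangent_space_at K z \<subseteq> {w. crit_normal z \<bullet> w = 0}"
proof -
  have "K \<subseteq> {z. crit_fun lam nu z = 0}"
    using assms by (auto simp: crit_set_def)
  from tangent_space_at_subset_kernel[OF this crit_fun_has_derivative] show ?thesis
    using Re_pos by auto
qed

lemma crit_normal_nonzero:
  assumes "crit_fun lam nu z = 0"
  shows "crit_normal z \<noteq> 0"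
proof
  assume "crit_normal z = 0"
  then have *: "2 * b * Re z = 1" "b * Im z = 0"
    by (simp_all add: crit_normal_def complex_eq_iff)
  then have "Im z = 0" by auto
  then have "Re z = b * (Re z * Re z)"
    using assms unfolding crit_fun_eq_0_iff cmod_power2 by (simp add: power2_eq_square)
  then show False using * by (auto simp: algebra_simps)
qed

lemma crit_differential_nonzero:
  assumes "crit_fun lam nu (Complex x y) = 0"
  shows "\<exists>D. ((\<lambda>(x, y). crit_fun lam nu (Complex x y)) has_derivative D) (at (x, y)) \<and> D \<noteq> (\<lambda>_. 0)"
proof (intro exI conjI)
  let ?C = "\<lambda>q :: real \<times> real. of_real (fst q) + \<i> * of_real (snd q) :: complex"
  let ?n = "crit_normal (Complex x y)"
  have C: "(?C has_derivative ?C) (at (x, y))"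
    by (auto intro!: derivative_eq_intros)
  have "((\<lambda>q. crit_fun lam nu (?C q)) has_derivative (\<lambda>q. 2 * a * (?n \<bullet> ?C q))) (at (x, y))"
    using has_derivative_compose[OF C, of "crit_fun lam nu" "\<lambda>w. 2 * a * (?n \<bullet> w)"]
      crit_fun_has_derivative[of "Complex x y"] by (simp add: Complex_eq)
  then show "((\<lambda>(x, y). crit_fun lam nu (Complex x y)) has_derivative (\<lambda>q. 2 * a * (?n \<bullet> ?C q))) (at (x, y))"
    by (simp add: case_prod_beta' Complex_eq)
  have "2 * a * (?n \<bullet> ?C (Re ?n, Im ?n)) \<noteq> 0"
    using crit_normal_nonzero[OF assms] Re_pos by (simp add: complex_eq[symmetric])
  then show "(\<lambda>q. 2 * a * (?n \<bullet> ?C q)) \<noteq> (\<lambda>_. 0)"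
    by metis
qed

text \<open>
  The circle \<open>Re z = b \<bar>z\<bar>\<^sup>2\<close> is the image of the line \<open>Re w = b\<close> under \<open>w \<mapsto> 1 / w\<close>; here
  \<open>w = b - i / u\<close>. Using \<open>u\<close> instead of \<open>1 / u\<close> as the parameter makes \<open>0\<close> an ordinary point
  and includes the line \<open>b = 0\<close>.
\<close>
definition crit_param :: "real \<Rightarrow> complex" where
  "crit_param u = \<i> * of_real u / (1 + \<i> * of_real (b * u))"

lemma Re_crit_param: "Re (crit_param u) = b * u^2 / (1 + (b * u)^2)"
  and Im_crit_param: "Im (crit_param u) = u / (1 + (b * u)^2)"
  by (simp_all add: crit_param_def Re_divide Im_divide power2_eq_square)

lemma norm_crit_param: "(norm (crit_param u))\<^sup>2 = u^2 / (1 + (b * u)^2)"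
proof -
  have "norm (1 + \<i> * complex_of_real (b * u)) ^ 2 = 1 + (b * u)^2"
    unfolding cmod_power2 by simp
  then show ?thesis by (simp add: crit_param_def norm_divide norm_mult power_divide)
qed

lemma crit_fun_param: "crit_fun lam nu (crit_param u) = 0"
  unfolding crit_fun_eq_0_iff norm_crit_param Re_crit_param by simp

lemma crit_param_saddle: "crit_param (1 / a) = p" "crit_param (- (1 / a)) = cnj p"
proof -
  have "lam0 = of_real a * (1 + \<i> * of_real (b * (1 / a)))"
    using Re_pos by (simp add: complex_eq_iff)
  then have p: "p = \<i> / (of_real a * (1 + \<i> * of_real (b * (1 / a))))" by simp
  show 1: "crit_param (1 / a) = p"
    unfolding p crit_param_def
    by (simp only: of_real_divide of_real_1 times_divide_eq_right mult_1_right divide_divide_eq_left)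
  have "crit_param (- (1 / a)) = cnj (crit_param (1 / a))"
    by (simp add: crit_param_def)
  then show "crit_param (- (1 / a)) = cnj p" using 1 by simp
qed

lemma crit_param_inj: "crit_param u = crit_param w \<longleftrightarrow> u = w"
proof
  assume "crit_param u = crit_param w"
  then have "\<i> * of_real u * (1 + \<i> * of_real (b * w)) = \<i> * of_real w * (1 + \<i> * of_real (b * u))"
    unfolding crit_param_def by (subst (asm) frac_eq_eq) (simp_all only: one_plus_nonzero not_False_eq_True)
  then show "u = w" by (simp add: complex_eq_iff)
qed simp

text \<open>
  The excluded point \<open>1 / b\<close> is the one opposite to \<open>0\<close>, which corresponds to an infinite parameter.
  Solving for the parameter gives \<open>i u = z / (1 - b z)\<close>, and the equation of the curve says that the
  right-hand side is purely imaginary.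
\<close>
lemma crit_set_parametrized:
  assumes "crit_fun lam nu z = 0" "of_real b * z \<noteq> 1"
  obtains u where "z = crit_param u"
proof
  let ?u = "Im (z / (1 - of_real b * z))"
  have nz: "1 - of_real b * z \<noteq> 0" using assms(2) by simp
  have "Re (z / (1 - of_real b * z)) = 0"
    using assms(1) unfolding crit_fun_eq_0_iff cmod_power2
    by (simp add: Re_divide power2_eq_square algebra_simps)
  then have "z / (1 - of_real b * z) = \<i> * of_real ?u"
    by (simp add: complex_eq_iff)
  then have "z = \<i> * of_real ?u * (1 - of_real b * z)"
    using nz by (simp add: field_simps)
  then have "z * (1 + \<i> * of_real (b * ?u)) = \<i> * of_real ?u"
    by (simp add: algebra_simps)
  then show "z = crit_param ?u"
    unfolding crit_param_def by (subst nonzero_eq_divide_eq) (simp_all only: one_plus_nonzero not_False_eq_True)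
qed

lemma norm_crit_param_le_iff: "norm (crit_param u) \<le> 1 / r \<longleftrightarrow> \<bar>a * u\<bar> \<le> 1"
proof -
  have "norm (crit_param u) \<le> 1 / r \<longleftrightarrow> (norm (crit_param u))\<^sup>2 \<le> (1 / r)\<^sup>2"
    using r_pos by (simp add: power_mono_iff)
  also have "\<dots> \<longleftrightarrow> u^2 * r^2 \<le> 1 + (b * u)^2"
    using r_pos one_plus_nonzero(4)[of "b * u"] by (simp add: norm_crit_param field_simps)
  also have "\<dots> \<longleftrightarrow> (a * u)^2 \<le> 1"
    unfolding r_sq by (simp add: algebra_simps power_mult_distrib)
  finally show ?thesis by (simp add: abs_square_le_1)
qed

definition central_arc :: "complex set" where
  "central_arc = crit_param ` {- (1 / a)..1 / a}"

text \<open>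
  The point \<open>1 / b\<close> is outside the disc because \<open>\<bar>b\<bar> < r\<close>, so the parametrization reaches every critical
  point in the disc.
\<close>
lemma central_arc_eq: "central_arc = {z. crit_fun lam nu z = 0} \<inter> cball 0 (1 / r)"
proof (intro equalityI subsetI)
  fix z assume "z \<in> central_arc"
  then obtain u where u: "z = crit_param u" "\<bar>u\<bar> \<le> 1 / a" by (auto simp: central_arc_def)
  then have "\<bar>a * u\<bar> \<le> 1" using Re_pos by (simp add: abs_mult field_simps)
  then show "z \<in> {z. crit_fun lam nu z = 0} \<inter> cball 0 (1 / r)"
    using u crit_fun_param norm_crit_param_le_iff by auto
next
  fix z assume z: "z \<in> {z. crit_fun lam nu z = 0} \<inter> cball 0 (1 / r)"
  have "norm (of_real b * z) \<le> \<bar>b\<bar> * (1 / r)"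
    using z mult_left_mono[of "norm z" "1 / r" "\<bar>b\<bar>"] by (simp add: norm_mult)
  also have "\<dots> < 1" using abs_b_less_r r_pos by simp
  finally have "of_real b * z \<noteq> 1" by auto
  then obtain u where u: "z = crit_param u" using z crit_set_parametrized by blast
  then have "\<bar>a * u\<bar> \<le> 1" using z norm_crit_param_le_iff by auto
  then have "\<bar>u\<bar> \<le> 1 / a" using Re_pos by (simp add: abs_mult field_simps)
  then have "u \<in> {- (1 / a)..1 / a}" by (auto simp: abs_le_iff)
  then show "z \<in> central_arc" using u by (auto simp: central_arc_def)
qed

text \<open>
  With \<open>w = 1 + i b u\<close>, where \<open>u = (1 - 2 t) / a\<close>, the first derivative of the parametrization with
  respect to \<open>t\<close> is a constant times \<open>1 / w\<^sup>2\<close>. As \<open>w\<close> is affine in \<open>t\<close>, all higher derivatives are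
  explicit powers of \<open>1 / w\<close>.
\<close>
lemma central_arc_smooth: "smooth_arc_between central_arc p (cnj p)"
proof -
  define c :: complex where "c = \<i> * of_real b * (- 2 / of_real a)"
  define w :: "complex \<Rightarrow> complex" where "w z = 1 + \<i> * of_real b * ((1 - 2 * z) / of_real a)" for z
  define g where "g t = crit_param ((1 - 2 * t) / a)" for t
  define C where "C m = \<i> * (- 2 / of_real a) * fact (Suc m) * (- c) ^ m" for m
  define D where "D n t = (case n of 0 \<Rightarrow> g t | Suc m \<Rightarrow> C m / w (of_real t) ^ (m + 2))" for n t
  have a: "of_real a \<noteq> (0 :: complex)" using Re_pos by simp
  have w_nz: "w (of_real t) \<noteq> 0" for t
    using one_plus_nonzero(1)[of "b * ((1 - 2 * t) / a)"] by (simp add: w_def mult.assoc)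
  have w': "(w has_field_derivative c) (at z)" for z
    unfolding w_def c_def using a by (auto intro!: derivative_eq_intros)
  have g: "g t = (\<i> * ((1 - 2 * of_real t) / of_real a)) / w (of_real t)" for t
    by (simp add: g_def crit_param_def w_def mult.assoc)
  have deriv: "(D n has_vector_derivative D (Suc n) t) (at t within {0..1})" for n t
  proof (cases n)
    case 0
    have "((\<lambda>z. \<i> * ((1 - 2 * z) / of_real a)) has_field_derivative \<i> * (- 2 / of_real a)) (at (of_real t))"
      using a by (auto intro!: derivative_eq_intros)
    from DERIV_divide[OF this w' w_nz]
    have "((\<lambda>z. (\<i> * ((1 - 2 * z) / of_real a)) / w z) has_field_derivative
        (\<i> * (- 2 / of_real a) * w (of_real t) - \<i> * ((1 - 2 * of_real t) / of_real a) * c) / w (of_real t) ^ 2)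
        (at (of_real t))"
      by (simp only: power2_eq_square)
    moreover have "\<i> * (- 2 / of_real a) * w (of_real t) - \<i> * ((1 - 2 * of_real t) / of_real a) * c
        = \<i> * (- 2 / of_real a)"
      using a by (simp add: w_def c_def field_simps)
    moreover have "D 1 t = \<i> * (- 2 / of_real a) / w (of_real t) ^ 2"
      by (simp add: D_def C_def numeral_2_eq_2)
    ultimately have "((\<lambda>z. (\<i> * ((1 - 2 * z) / of_real a)) / w z) has_field_derivative D 1 t) (at (of_real t))"
      by (simp only:)
    moreover have "D 0 = (\<lambda>t. (\<i> * ((1 - 2 * of_real t) / of_real a)) / w (of_real t))"
      by (auto simp: D_def g)
    ultimately show ?thesis
      using 0 has_vector_derivative_real_field by fastforce
  next
    case (Suc m)
    define W where "W = w (of_real t)"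
    have "W \<noteq> 0" using w_nz by (simp add: W_def)
    have "((\<lambda>z. C m / w z ^ (m + 2)) has_field_derivative
        (0 * W ^ (m + 2) - C m * (of_nat (m + 2) * (c * W ^ (m + 1)))) / (W ^ (m + 2) * W ^ (m + 2))) (at (of_real t))"
      using DERIV_divide[OF DERIV_const DERIV_power[OF w', of "m + 2"], of "of_real t" "C m"] \<open>W \<noteq> 0\<close>
      by (simp add: W_def)
    moreover have "W ^ (m + 2) * W ^ (m + 2) = W ^ (m + 3) * W ^ (m + 1)"
      unfolding power_add[symmetric] by (rule arg_cong[where f="\<lambda>n. W ^ n"]) simp
    moreover have "0 * W ^ (m + 2) - C m * (of_nat (m + 2) * (c * W ^ (m + 1))) = C (Suc m) * W ^ (m + 1)"
      by (simp add: C_def algebra_simps add_divide_distrib)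
    moreover have "C (Suc m) * W ^ (m + 1) / (W ^ (m + 3) * W ^ (m + 1)) = D (Suc n) t"
      using \<open>W \<noteq> 0\<close> Suc by (simp add: D_def W_def eval_nat_numeral)
    ultimately have "((\<lambda>z. C m / w z ^ (m + 2)) has_field_derivative D (Suc n) t) (at (of_real t))"
      by (simp only:)
    moreover have "D n = (\<lambda>t. C m / w (of_real t) ^ (m + 2))"
      using Suc by (auto simp: D_def)
    ultimately show ?thesis
      using has_vector_derivative_real_field by fastforce
  qed
  have D0: "D 0 = g" by (auto simp: D_def)
  have "continuous_on {0..1} g"
    using deriv[of 0] unfolding D0
    unfolding continuous_on_eq_continuous_within by (blast intro: has_vector_derivative_continuous)
  moreover have "inj_on g {0..1}"
    using Re_pos by (auto simp: inj_on_def g_def crit_param_inj)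
  ultimately have "arc g"
    by (simp add: arc_def path_def)
  moreover have "path_image g = central_arc"
  proof -
    have "(\<lambda>t. (1 - 2 * t) / a) ` {0..1} = {- (1 / a)..1 / a}"
    proof (intro equalityI subsetI)
      fix u assume u: "u \<in> {- (1 / a)..1 / a}"
      then have "- 1 \<le> a * u" "a * u \<le> 1" using Re_pos by (auto simp: field_simps)
      then show "u \<in> (\<lambda>t. (1 - 2 * t) / a) ` {0..1}"
        using Re_pos by (intro image_eqI[of _ _ "(1 - a * u) / 2"]) (auto simp: field_simps)
    qed (use Re_pos in \<open>auto simp: field_simps\<close>)
    then show ?thesis
      unfolding path_image_def central_arc_def g_def by (metis image_image)
  qed
  moreover have "pathstart g = p" "pathfinish g = cnj p"
    using crit_param_saddle by (simp_all add: g_def pathstart_def pathfinish_def)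
  moreover have "D 1 t \<noteq> 0" for t
    using w_nz[of t] a by (simp add: D_def C_def)
  ultimately show ?thesis
    unfolding smooth_arc_between_def using D0 deriv by blast
qed

section \<open>Sufficiency of the inequality\<close>

lemma hyp_B1_central_arc:
  assumes "cball 0 (1 / r) \<subseteq> S"
  shows "hyp_B1 lam nu S p central_arc"
proof -
  have "0 \<in> central_arc"
    using r_pos by (simp add: central_arc_eq crit_fun_eq)
  then show ?thesis
    unfolding hyp_B1_def
    using central_arc_smooth assms crit_differential_nonzero by (auto simp: central_arc_eq crit_set_def)
qed

lemma field_at_param: "elliptic_field lam (crit_param u) = of_real (1 - a * u) / (1 - \<i> * of_real (b * u))"
proof -
  have "lam (crit_param u) = (\<i> * of_real u * lam0 - \<i> * (1 + \<i> * of_real (b * u))) / (1 + \<i> * of_real (b * u))"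
    unfolding crit_param_def diff_divide_distrib using one_plus_nonzero(1)[of "b * u"] by simp
  also have "\<i> * of_real u * lam0 - \<i> * (1 + \<i> * of_real (b * u)) = - \<i> * of_real (1 - a * u)"
    by (simp add: complex_eq_iff)
  finally show ?thesis
    by (simp add: elliptic_field_def)
qed

lemma crit_normal_at_param: "crit_normal (crit_param u) = (1 - \<i> * of_real (b * u)) / (1 + \<i> * of_real (b * u))"
  unfolding crit_normal_def crit_param_def using one_plus_nonzero(1)[of "b * u"] by (simp add: field_simps)

text \<open>
  With \<open>q = 1 + i b u\<close> the field is \<open>(1 - a u) / cnj q\<close> and the normal is \<open>cnj q / q\<close>, so the inner
  product is the real part of \<open>(1 - a u) q\<^sup>3 / \<bar>q\<bar>\<^sup>4\<close>. The cube is what produces the factor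
  \<open>1 - 3 (b u)\<^sup>2\<close> and thus the constant \<open>sqrt 3\<close>.
\<close>
lemma field_dot_normal:
  "elliptic_field lam (crit_param u) \<bullet> crit_normal (crit_param u) = (1 - a * u) * (1 - 3 * (b * u)\<^sup>2) / (1 + (b * u)\<^sup>2)\<^sup>2"
proof -
  define t where "t = b * u"
  define q where "q = 1 + \<i> * of_real t"
  have q: "cnj q = 1 - \<i> * of_real t" "q * cnj q = of_real (1 + t\<^sup>2)" "q \<noteq> 0"
    using one_plus_nonzero by (simp_all add: q_def algebra_simps power2_eq_square)
  have "elliptic_field lam (crit_param u) \<bullet> crit_normal (crit_param u) = Re (of_real (1 - a * u) / cnj q * cnj (cnj q / q))"
    unfolding field_at_param crit_normal_at_param t_def[symmetric] q(1)[symmetric] q_def[symmetric]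
    by (rule inner_eq_Re_mult_cnj)
  also have "of_real (1 - a * u) / cnj q * cnj (cnj q / q) = of_real (1 - a * u) * q ^ 3 / (q * cnj q) ^ 2"
    using q(3) by (simp add: field_simps eval_nat_numeral)
  also have "\<dots> = of_real ((1 - a * u) / (1 + t\<^sup>2)\<^sup>2) * q ^ 3"
    unfolding q(2) by simp
  also have "Re \<dots> = (1 - a * u) / (1 + t\<^sup>2)\<^sup>2 * (1 - 3 * t\<^sup>2)"
    by (simp add: q_def eval_nat_numeral algebra_simps)
  finally show ?thesis by (simp add: t_def)
qed

text \<open>
  The vectors from \<open>p\<close> to \<open>- 1 / r\<close> and \<open>1 / r\<close> span the stable and the unstable line. So the critical
  curve is tangent at \<open>p\<close> to the stable line iff \<open>r = 2 b\<close>, and to the unstable line iff \<open>r = - 2 b\<close>.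
\<close>
lemma crit_normal_p_dot:
  "crit_normal p \<bullet> (of_real (- (1 / r)) - p) = - ((r + b) * (r - 2 * b) / r ^ 3)"
  "crit_normal p \<bullet> (of_real (1 / r) - p) = (r - b) * (r + 2 * b) / r ^ 3"
proof -
  have *: "crit_normal p \<bullet> (of_real x - p) = x + b / r^2 - 2 * b^2 * x / r^2" for x
  proof -
    have "crit_normal z \<bullet> (of_real x - z) = x - 2 * b * x * Re z - Re z + 2 * b * (norm z)\<^sup>2" for z
      unfolding cmod_power2 by (simp add: crit_normal_def inner_complex_def algebra_simps power2_eq_square)
    from this[of p] show ?thesis
      unfolding norm_p Re_p by (simp add: power_divide power2_eq_square)
  qed
  show "crit_normal p \<bullet> (of_real (- (1 / r)) - p) = - ((r + b) * (r - 2 * b) / r ^ 3)"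
    "crit_normal p \<bullet> (of_real (1 / r) - p) = (r - b) * (r + 2 * b) / r ^ 3"
    unfolding * using r_pos by (simp_all add: field_simps eval_nat_numeral)
qed

text \<open>
  A common tangent vector lies on the line spanned by \<open>x - p\<close> and is orthogonal to the normal of the
  critical curve. These conditions determine two different lines through \<open>0\<close>.
\<close>
lemma transversal_at_saddle:
  assumes K: "K \<subseteq> crit_set lam nu S" and M: "M \<subseteq> {z. (z - p) \<bullet> v = 0}" and v: "v \<noteq> 0"
    and x: "(x - p) \<bullet> v = 0" "crit_normal p \<bullet> (x - p) \<noteq> 0"
  shows "tangent_space_at K p \<inter> tangent_space_at M p = {0}"
proof -
  have "w = 0" if w: "w \<in> tangent_space_at K p" "w \<in> tangent_space_at M p" for w
  proof -
    have n: "crit_normal p \<bullet> w = 0"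
      using tangent_space_orthogonal_normal[OF K] w(1) by blast
    have "((\<lambda>z. (z - p) \<bullet> v) has_derivative (\<lambda>w. w \<bullet> v)) (at p)"
      by (auto intro!: derivative_eq_intros)
    from tangent_space_at_subset_kernel[OF M this] have "v \<bullet> w = 0"
      using w(2) by (auto simp: inner_commute)
    moreover have "v \<bullet> (x - p) = 0" "x - p \<noteq> 0"
      using x by (auto simp: inner_commute)
    ultimately obtain s where "w = s *\<^sub>R (x - p)"
      using orthogonal_complex_span[OF v] by (metis span_breakdown_eq span_empty singletonD eq_iff_diff_eq_0)
    then show "w = 0" using n x(2) by auto
  qed
  moreover have "0 \<in> tangent_space_at K p" "0 \<in> tangent_space_at M p"
    unfolding tangent_space_at_def by (rule span_zero)+
  ultimately show ?thesis by blast
qed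

lemma hyp_B2_central_arc:
  assumes S: "convex S" "cball 0 (1 / r) \<subseteq> S" and b: "2 * \<bar>b\<bar> < r"
  shows "hyp_B2 lam S p central_arc"
proof -
  have p: "p \<in> S" using norm_p by (auto intro!: subsetD[OF S(2)])
  have K: "central_arc \<subseteq> crit_set lam nu S"
    using S(2) by (auto simp: central_arc_eq crit_set_def)
  have nz: "(r + b) * (r - 2 * b) / r ^ 3 \<noteq> 0" "(r - b) * (r + 2 * b) / r ^ 3 \<noteq> 0"
    using b r_pos by auto
  have "tangent_space_at central_arc p \<inter> tangent_space_at (stable_manifold lam S p) p = {0}"
    by (rule transversal_at_saddle[OF K _ dirs_nonzero(2), of _ "of_real (- (1 / r))"])
      (use nz in \<open>auto simp only: stable_manifold_line[OF S(1) p] real_on_stable_line crit_normal_p_dot neg_equal_0_iff_equal\<close>)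
  moreover have "tangent_space_at central_arc p \<inter> tangent_space_at (unstable_manifold lam S p) p = {0}"
    by (rule transversal_at_saddle[OF K _ dirs_nonzero(1), of _ "of_real (1 / r)"])
      (use nz in \<open>auto simp only: unstable_manifold_line[OF S(1) p] real_on_unstable_line crit_normal_p_dot\<close>)
  moreover have "elliptic_field lam z \<notin> tangent_space_at central_arc z" if z: "z \<in> central_arc - {p, cnj p}" for z
  proof
    assume "elliptic_field lam z \<in> tangent_space_at central_arc z"
    then have 0: "elliptic_field lam z \<bullet> crit_normal z = 0"
      using tangent_space_orthogonal_normal[OF K, of z] by (auto simp: inner_commute)
    obtain u where u: "z = crit_param u" "\<bar>u\<bar> \<le> 1 / a"
      using z by (auto simp: central_arc_def)
    have "u \<noteq> 1 / a" using z u crit_param_saddle by auto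
    then have "a * u \<noteq> 1" using Re_pos by (auto simp: field_simps)
    then have "3 * (b * u)\<^sup>2 = 1"
      using 0 one_plus_nonzero(3)[of "b * u"] unfolding u field_dot_normal by simp
    moreover have "(a * u)\<^sup>2 \<le> 1"
      unfolding abs_square_le_1 using u(2) Re_pos by (simp add: abs_mult field_simps)
    moreover have "4 * b\<^sup>2 < r\<^sup>2"
      using power_strict_mono[OF b, of 2] by (simp add: power_mult_distrib)
    then have "3 * b\<^sup>2 < a\<^sup>2" unfolding r_sq by simp
    moreover have "u \<noteq> 0" using \<open>3 * (b * u)\<^sup>2 = 1\<close> by auto
    then have "3 * b\<^sup>2 * u\<^sup>2 < a\<^sup>2 * u\<^sup>2"
      using \<open>3 * b\<^sup>2 < a\<^sup>2\<close> by (intro mult_strict_right_mono) auto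
    ultimately show False
      unfolding power_mult_distrib by linarith
  qed
  ultimately show ?thesis unfolding hyp_B2_def by blast
qed

text \<open>
  The proof gives the barycentric coordinates: with \<open>w = a u\<close> and \<open>Q = 1 + b\<^sup>2 u\<^sup>2\<close>, the coordinate of
  \<open>p\<close> is \<open>\<gamma>\<close>, and those of \<open>- 1 / r\<close> and \<open>1 / r\<close> are \<open>P 1\<close> and \<open>P (- 1)\<close>. The latter are
  the distances to the opposite legs, up to positive factors; they are nonnegative because the line through
  a leg meets the critical curve at \<open>p\<close> and at no parameter in \<open>0 \<le> u < 1 / a\<close>.
\<close>
lemma crit_param_in_triangle:
  assumes b: "2 * \<bar>b\<bar> \<le> r" and u: "0 \<le> u" "u \<le> 1 / a"
  shows "crit_param u \<in> convex hull {p, of_real (- (1 / r)), of_real (1 / r)}"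
proof -
  define w where "w = a * u"
  define Q where "Q = 1 + (b * u)\<^sup>2"
  have w: "0 \<le> w" "w \<le> 1" "u = w / a" using u Re_pos by (auto simp: w_def field_simps)
  have Q: "Q > 0" using one_plus_nonzero by (simp add: Q_def)
  define \<gamma> where "\<gamma> = w * r^2 / a^2 / Q"
  define P where "P \<sigma> = (1 - w) * (1 - b^2 * w / a^2 + \<sigma> * b * w * r / a^2) / (2 * Q)" for \<sigma>
  have P: "P \<sigma> \<ge> 0" if "\<bar>\<sigma>\<bar> = 1" for \<sigma>
  proof -
    (* The claim amounts to \<bar>b\<bar> w \<le> r - \<bar>b\<bar>, by a\<^sup>2 = (r - \<bar>b\<bar>) (r + \<bar>b\<bar>); the bound 2 \<bar>b\<bar> \<le> r
       is what makes it true up to w = 1. *)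
    have "\<bar>b\<bar> * w \<le> \<bar>b\<bar> * 1"
      using w by (intro mult_left_mono) auto
    then have "\<bar>b\<bar> * w * (r + \<bar>b\<bar>) \<le> (r - \<bar>b\<bar>) * (r + \<bar>b\<bar>)"
      using b r_pos by (intro mult_right_mono) auto
    also have "\<dots> = a^2"
      using r_sq by (simp add: algebra_simps power2_eq_square)
    finally have "\<bar>b\<bar> * w * r + b^2 * w \<le> a^2"
      by (simp add: algebra_simps power2_eq_square)
    moreover have "\<bar>\<sigma> * b * w * r\<bar> = \<bar>b\<bar> * w * r"
      using that w(1) r_pos by (simp add: abs_mult)
    ultimately have "0 \<le> a^2 - b^2 * w + \<sigma> * b * w * r" by linarith
    moreover have "1 - b^2 * w / a^2 + \<sigma> * b * w * r / a^2 = (a^2 - b^2 * w + \<sigma> * b * w * r) / a^2"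
      using Re_pos by (simp add: field_simps)
    ultimately show ?thesis
      unfolding P_def using w Q by simp
  qed
  have Q': "Q * a^2 = a^2 + b^2 * w^2"
    using Re_pos by (simp add: Q_def w(3) field_simps)
  have sum: "\<gamma> + P 1 + P (- 1) = 1"
  proof -
    have "\<gamma> + P 1 + P (- 1) = (w * r^2 + (1 - w) * (a^2 - b^2 * w)) / (Q * a^2)"
      unfolding \<gamma>_def P_def using Q Re_pos by (simp add: field_simps)
    also have "w * r^2 + (1 - w) * (a^2 - b^2 * w) = Q * a^2"
      unfolding Q' r_sq by (simp add: algebra_simps power2_eq_square)
    finally show ?thesis using Q Re_pos by simp
  qed
  have "crit_param u = \<gamma> *\<^sub>R p + P 1 *\<^sub>R of_real (- (1 / r)) + P (- 1) *\<^sub>R of_real (1 / r)"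
  proof (rule complex_eqI)
    have "P (- 1) - P 1 = - ((1 - w) * b * w * r / a^2 / Q)"
      unfolding P_def using Q Re_pos by (simp add: field_simps)
    moreover have "\<gamma> * (b / r^2) = w * b / a^2 / Q"
      unfolding \<gamma>_def using r_pos by simp
    moreover have "Re (crit_param u) = b * w^2 / a^2 / Q"
      unfolding Re_crit_param Q_def[symmetric] by (simp add: w(3) power_divide)
    moreover have "b * w^2 / a^2 / Q = w * b / a^2 / Q + - ((1 - w) * b * w * r / a^2 / Q) * (1 / r)"
      using r_pos Q Re_pos by (simp add: field_simps power2_eq_square)
    ultimately have "Re (crit_param u) = \<gamma> * (b / r^2) + (P (- 1) - P 1) * (1 / r)"
      by simp
    then show "Re (crit_param u) = Re (\<gamma> *\<^sub>R p + P 1 *\<^sub>R of_real (- (1 / r)) + P (- 1) *\<^sub>R of_real (1 / r))"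
      unfolding plus_complex.sel scaleR_complex.sel Re_p Re_complex_of_real by (simp add: left_diff_distrib diff_divide_distrib)
    have "Im (crit_param u) = \<gamma> * (a / r^2)"
      unfolding Im_crit_param Q_def[symmetric] \<gamma>_def using r_pos Re_pos Q by (simp add: w(3) field_simps power2_eq_square)
    then show "Im (crit_param u) = Im (\<gamma> *\<^sub>R p + P 1 *\<^sub>R of_real (- (1 / r)) + P (- 1) *\<^sub>R of_real (1 / r))"
      unfolding plus_complex.sel scaleR_complex.sel Im_p Im_complex_of_real by simp
  qed
  moreover have "\<gamma> \<ge> 0" using w Q by (simp add: \<gamma>_def)
  ultimately show ?thesis
    unfolding convex_hull_3 using sum P[of 1] P[of "- 1"] by auto
qed

text \<open>
  The triangle lies in the disc \<open>\<bar>z\<bar> \<le> 1 / r\<close>, where every critical point is on the arc, and in the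
  upper half plane, which cuts the arc down to the parameters \<open>0 \<le> u \<le> 1 / a\<close>.
\<close>
lemma hyp_B3_central_arc:
  assumes S: "convex S" "cball 0 (1 / r) \<subseteq> S" and b: "2 * \<bar>b\<bar> \<le> r"
  shows "hyp_B3 lam nu S p (- (1 / r)) (1 / r) central_arc"
proof -
  let ?R = "convex hull {p, of_real (- (1 / r)), of_real (1 / r)} :: complex set"
  have "?R \<subseteq> cball 0 (1 / r)"
    by (rule hull_minimal) (use r_pos norm_p in \<open>auto simp: norm_divide\<close>)
  have "?R \<subseteq> {z. Im z \<ge> 0}"
    by (rule hull_minimal) (use Im_p Re_pos in \<open>auto simp: convex_halfspace_Im_ge simp del: of_real_minus of_real_divide\<close>)
  have C: "crit_set lam nu S \<inter> ?R = central_arc \<inter> ?R"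
    using \<open>?R \<subseteq> cball 0 (1 / r)\<close> S(2) by (auto simp: central_arc_eq crit_set_def)
  also have "\<dots> = crit_param ` {0..1 / a}"
  proof (intro equalityI subsetI)
    fix z assume z: "z \<in> central_arc \<inter> ?R"
    then obtain u where u: "z = crit_param u" "u \<le> 1 / a" by (auto simp: central_arc_def)
    have "Im (crit_param u) \<ge> 0" using z u \<open>?R \<subseteq> {z. Im z \<ge> 0}\<close> by blast
    then have "u \<ge> 0"
      using one_plus_nonzero(4)[of "b * u"] by (simp add: Im_crit_param zero_le_divide_iff)
    then show "z \<in> crit_param ` {0..1 / a}" using u by auto
  next
    fix z assume "z \<in> crit_param ` {0..1 / a}"
    then obtain u where u: "z = crit_param u" "0 \<le> u" "u \<le> 1 / a" by auto
    have "- (1 / a) \<le> 0" using Re_pos by simp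
    then have "u \<in> {- (1 / a)..1 / a}" using u by auto
    then show "z \<in> central_arc \<inter> ?R"
      using crit_param_in_triangle[OF b] u unfolding central_arc_def by blast
  qed
  finally have "crit_set lam nu S \<inter> ?R = crit_param ` {0..1 / a}" .
  moreover have "continuous_on {0..1 / a} crit_param"
    unfolding crit_param_def[abs_def] by (intro continuous_intros ballI one_plus_nonzero)
  then have "connected (crit_param ` {0..1 / a})"
    by (rule connected_continuous_image) simp
  ultimately have "connected (crit_set lam nu S \<inter> ?R)" "crit_set lam nu S \<inter> ?R \<noteq> {}"
    using Re_pos by auto
  then show ?thesis
    unfolding hyp_B3_def saddle_region_eq[OF S] C[symmetric] by (simp only: components_eq_sing_iff simp_thms)
qed

section \<open>Necessity of the inequality\<close>

text \<open>
  The derivative of the parametrization is a nonzero tangent vector of \<open>K\<close> and is orthogonal to the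
  normal, so it spans the tangent line of the critical curve. Only forward velocities are used, hence
  the final point of the arc is left out.
\<close>
lemma tangent_space_of_smooth_arc:
  assumes K: "K \<subseteq> crit_set lam nu S" and arc: "smooth_arc_between K q q'"
    and z: "z \<in> K" "z \<noteq> q'" and w: "crit_normal z \<bullet> w = 0"
  shows "w \<in> tangent_space_at K z"
proof -
  obtain g D where g: "path_image g = K" "pathfinish g = q'" "D 0 = g"
    and D: "\<And>n t. t \<in> {0..1} \<Longrightarrow> (D n has_vector_derivative D (Suc n) t) (at t within {0..1})"
    and D1: "\<And>t. t \<in> {0..1} \<Longrightarrow> D 1 t \<noteq> 0"
    using arc unfolding smooth_arc_between_def by blast
  obtain t where t: "t \<in> {0..1}" "z = g t"
    using z(1) g(1) by (auto simp: path_image_def)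
  have "t < 1"
    using t z(2) g(2) by (cases "t = 1") (auto simp: pathfinish_def)
  have "(D 0 has_vector_derivative D 1 t) (at t within (+) t ` {0..1 - t})"
    using D[OF t(1), of 0] t(1) by (auto intro: has_vector_derivative_within_subset)
  then have "(g \<circ> (+) t has_vector_derivative 1 *\<^sub>R D 1 t) (at 0 within {0..1 - t})"
    by (intro vector_diff_chain_within) (auto intro!: derivative_eq_intros simp: g(3))
  then have D_tangent: "D 1 t \<in> tangent_space_at K z"
    using \<open>t < 1\<close> t g(1)
    by (intro velocity_in_tangent_space[of "1 - t" "g \<circ> (+) t"]) (auto simp: path_image_def)
  have "crit_fun lam nu z = 0"
    using z(1) K by (auto simp: crit_set_def)
  then have "crit_normal z \<noteq> 0" by (rule crit_normal_nonzero)
  moreover have "crit_normal z \<bullet> D 1 t = 0"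
    using subsetD[OF tangent_space_orthogonal_normal[OF K] D_tangent] by simp
  ultimately have "w \<in> span {D 1 t}"
    using D1[OF t(1)] w by (rule orthogonal_complex_span)
  also have "span {D 1 t} \<subseteq> tangent_space_at K z"
    using D_tangent unfolding tangent_space_at_def by (intro span_minimal subspace_span) simp
  finally show ?thesis .
qed

text \<open>
  The line through the point with parameter \<open>u\<close> and \<open>cnj p\<close> separates \<open>p\<close> from \<open>0\<close>, and it meets
  the circle only in these two points. The part of \<open>K\<close> from \<open>p\<close> to \<open>0\<close> is connected, so it crosses
  the line, and it cannot do so at \<open>cnj p\<close>, which is the other end of the injective path.
\<close>
lemma smooth_arc_contains_crit_param:
  assumes K: "K \<subseteq> crit_set lam nu S" and arc: "smooth_arc_between K p (cnj p)" and "0 \<in> K"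
    and b: "b \<noteq> 0" and u: "0 < u" "u < 1 / a"
  shows "crit_param u \<in> K"
proof -
  obtain g where g: "arc g" "path_image g = K" "g 0 = p" "g 1 = cnj p"
    using arc unfolding smooth_arc_between_def pathstart_def pathfinish_def by blast
  obtain s where s: "0 \<le> s" "s \<le> 1" "g s = 0"
    using \<open>0 \<in> K\<close> g(2) by (auto simp: path_image_def)
  have "s \<noteq> 1" using s g lam0_nz by auto
  (* The affine function whose zero set is this line, scaled such that on the curve it becomes the monic
     quadratic with roots u and - 1 / a, divided by 1 + (b x)\<^sup>2. *)
  define N where "N z = (1 + u * b^2 / a) / b * Re z + (1 / a - u) * Im z - u / a" for z
  have Nk: "N (crit_param x) = (x - u) * (x + 1 / a) / (1 + (b * x)\<^sup>2)" for x
  proof -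
    have "N (crit_param x) = ((1 + u * b^2 / a) / b * (b * x^2) + (1 / a - u) * x - u / a * (1 + (b * x)\<^sup>2)) / (1 + (b * x)\<^sup>2)"
      unfolding N_def Re_crit_param Im_crit_param using one_plus_nonzero(3)[of "b * x"] by (simp add: add_divide_distrib diff_divide_distrib)
    also have "(1 + u * b^2 / a) / b * (b * x^2) + (1 / a - u) * x - u / a * (1 + (b * x)\<^sup>2) = (x - u) * (x + 1 / a)"
      using b Re_pos by (simp add: field_simps power2_eq_square)
    finally show ?thesis .
  qed
  have "N (g 0) \<ge> 0"
    using Nk[of "1 / a"] u Re_pos one_plus_nonzero(4)[of "b * (1 / a)"] by (simp add: g crit_param_saddle)
  moreover have "N (g s) \<le> 0"
    using u Re_pos by (simp add: N_def s)
  moreover have "continuous_on {0..s} (\<lambda>t. N (g t))"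
  proof -
    have "continuous_on {0..s} g"
      using g(1) s(2) by (auto simp: arc_def path_def intro: continuous_on_subset)
    then show ?thesis unfolding N_def by (intro continuous_intros)
  qed
  ultimately obtain t where t: "0 \<le> t" "t \<le> s" "N (g t) = 0"
    using IVT2'[of "\<lambda>t. N (g t)" s 0 0] s by auto
  have gt: "g t \<in> K"
    using t s g(2) by (auto simp: path_image_def)
  then have "crit_fun lam nu (g t) = 0" using K by (auto simp: crit_set_def)
  moreover have "of_real b * g t \<noteq> 1"
  proof
    assume "of_real b * g t = 1"
    then have "g t = of_real (1 / b)" using b by (simp add: field_simps)
    then have "N (g t) = N (of_real (1 / b))" by (simp only:)
    also have "\<dots> = 1 / b^2"
      unfolding N_def Re_complex_of_real Im_complex_of_real
      using b Re_pos by (simp add: field_simps power2_eq_square)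
    finally have "N (g t) = 1 / b^2" .
    then show False using t b by simp
  qed
  ultimately obtain x where x: "g t = crit_param x" using crit_set_parametrized by blast
  have "(x - u) * (x + 1 / a) = 0"
    using t(3) one_plus_nonzero(3)[of "b * x"] unfolding x Nk by simp
  moreover have "x \<noteq> - (1 / a)"
  proof
    assume "x = - (1 / a)"
    then have "g t = g 1" using x crit_param_saddle g(4) by simp
    moreover have "inj_on g {0..1}" using g(1) by (simp add: arc_def)
    ultimately have "t = 1" using t s by (auto dest: inj_onD)
    then show False using t s \<open>s \<noteq> 1\<close> by simp
  qed
  ultimately have "x = u" by auto
  then show ?thesis using gt x by simp
qed

text \<open>
  If \<open>r = 2 \<bar>b\<bar>\<close>, then \<open>K\<close> is tangent at \<open>p\<close> to one of the invariant manifolds. If \<open>r < 2 \<bar>b\<bar>\<close>, then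
  the contact point with parameter \<open>1 / (sqrt 3 \<bar>b\<bar>)\<close> lies between \<open>0\<close> and \<open>p\<close>, hence in \<open>K\<close>. Both
  contradict B2.
\<close>
lemma two_b_less_r_if_hyps:
  assumes S: "convex S" "cball 0 (1 / r) \<subseteq> S" and B1: "hyp_B1 lam nu S p K" and B2: "hyp_B2 lam S p K"
  shows "2 * \<bar>b\<bar> < r"
proof (rule ccontr)
  assume "\<not> 2 * \<bar>b\<bar> < r"
  then have br: "r \<le> 2 * \<bar>b\<bar>" by simp
  then have b: "b \<noteq> 0" using r_pos by auto
  have K: "K \<subseteq> crit_set lam nu S" "smooth_arc_between K p (cnj p)" "0 \<in> K"
    using B1 by (auto simp: hyp_B1_def)
  have p_mem: "p \<in> S" "of_real (- (1 / r)) \<in> S" "of_real (1 / r) \<in> S"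
    using S(2) r_pos norm_p by (auto intro!: subsetD[OF S(2)] simp: norm_divide)
  show False
  proof (cases "r = 2 * \<bar>b\<bar>")
    case True
    have "p \<noteq> cnj p" using crit_param_saddle crit_param_inj[of "1 / a" "- (1 / a)"] Re_pos by auto
    moreover have "p \<in> K"
      using K(2) pathstart_in_path_image unfolding smooth_arc_between_def by metis
    ultimately have tangent_K: "w \<in> tangent_space_at K p" if "crit_normal p \<bullet> w = 0" for w
      using tangent_space_of_smooth_arc[OF K(1,2)] that by blast
    have tangent_line: "x - p \<in> tangent_space_at {z \<in> S. (z - p) \<bullet> v = 0} p"
      if "x \<in> S" "(x - p) \<bullet> v = 0" for x v
    proof (rule velocity_in_tangent_space[of 1 "\<lambda>t. p + t *\<^sub>R (x - p)"])
      have "(1 - t) *\<^sub>R p + t *\<^sub>R x \<in> S" if "t \<in> {0..1}" for t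
        using that S(1) p_mem(1) \<open>x \<in> S\<close> by (auto intro!: convexD)
      moreover have "(1 - t) *\<^sub>R p + t *\<^sub>R x = p + t *\<^sub>R (x - p)" for t
        by (simp add: algebra_simps)
      ultimately show "(\<lambda>t. p + t *\<^sub>R (x - p)) ` {0..1} \<subseteq> {z \<in> S. (z - p) \<bullet> v = 0}"
        using that by auto
    qed (auto intro!: derivative_eq_intros)
    show False
    proof (cases "b > 0")
      case pos: True
      let ?x = "of_real (- (1 / r)) :: complex"
      have "?x - p \<in> tangent_space_at K p"
        by (rule tangent_K, unfold crit_normal_p_dot) (use True pos in simp)
      moreover have "?x - p \<in> tangent_space_at (stable_manifold lam S p) p"
        unfolding stable_manifold_line[OF S(1) p_mem(1)]
        by (rule tangent_line) (use p_mem real_on_stable_line in \<open>blast+\<close>)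
      ultimately have "?x - p = 0" using B2 unfolding hyp_B2_def by blast
      then show False using Im_p Re_pos r_pos by (auto simp: complex_eq_iff simp del: of_real_minus of_real_divide)
    next
      case False
      let ?x = "of_real (1 / r) :: complex"
      have "?x - p \<in> tangent_space_at K p"
        by (rule tangent_K, unfold crit_normal_p_dot) (use True False in simp)
      moreover have "?x - p \<in> tangent_space_at (unstable_manifold lam S p) p"
        unfolding unstable_manifold_line[OF S(1) p_mem(1)]
        by (rule tangent_line) (use p_mem real_on_unstable_line in \<open>blast+\<close>)
      ultimately have "?x - p = 0" using B2 unfolding hyp_B2_def by blast
      then show False using Im_p Re_pos r_pos by (auto simp: complex_eq_iff simp del: of_real_minus of_real_divide)
    qed
  next
    case False
    with br have "r\<^sup>2 < (2 * \<bar>b\<bar>)\<^sup>2"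
      using r_pos by (intro power_strict_mono) auto
    then have ab: "a\<^sup>2 < (sqrt 3 * \<bar>b\<bar>)\<^sup>2"
      unfolding r_sq by (simp add: power_mult_distrib)
    then have "a < sqrt 3 * \<bar>b\<bar>"
      by (rule power2_less_imp_less) simp
    define u where "u = 1 / (sqrt 3 * \<bar>b\<bar>)"
    have u: "0 < u" "u < 1 / a"
      using b Re_pos \<open>a < sqrt 3 * \<bar>b\<bar>\<close> by (auto simp: u_def intro!: divide_strict_left_mono)
    have "crit_param u \<in> K"
      by (rule smooth_arc_contains_crit_param[OF K b u])
    moreover have "crit_param u \<noteq> crit_param (1 / a)" "crit_param u \<noteq> crit_param (- (1 / a))"
      unfolding crit_param_inj using u by auto
    then have "crit_param u \<noteq> p" "crit_param u \<noteq> cnj p"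
      unfolding crit_param_saddle .
    moreover have "3 * (b * u)\<^sup>2 = 1"
      using b by (simp add: u_def power_mult_distrib power_divide)
    then have "crit_normal (crit_param u) \<bullet> elliptic_field lam (crit_param u) = 0"
      using field_dot_normal[of u] by (simp add: inner_commute)
    ultimately have "crit_param u \<in> K - {p, cnj p}" "elliptic_field lam (crit_param u) \<in> tangent_space_at K (crit_param u)"
      using tangent_space_of_smooth_arc[OF K(1,2)] by blast+
    then show False
      using B2 unfolding hyp_B2_def by blast
  qed
qed

lemma two_b_less_r_iff: "2 * \<bar>b\<bar> < r \<longleftrightarrow> sqrt 3 * \<bar>b\<bar> < a"
proof -
  have "2 * \<bar>b\<bar> < r \<longleftrightarrow> (2 * \<bar>b\<bar>)\<^sup>2 < r\<^sup>2"
    by (rule real_less_iff_square_less) auto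
  also have "\<dots> \<longleftrightarrow> (sqrt 3 * \<bar>b\<bar>)\<^sup>2 < a\<^sup>2"
    unfolding r_sq by (simp add: power_mult_distrib)
  also have "\<dots> \<longleftrightarrow> sqrt 3 * \<bar>b\<bar> < a"
    using Re_pos by (intro real_less_iff_square_less[symmetric]) auto
  finally show ?thesis .
qed

end

section \<open>The characterization\<close>

theorem proposition1p4:
  fixes lam0 :: complex and \<alpha> \<beta> lam nu :: "complex \<Rightarrow> complex"
  assumes "Re lam0 > 0"
    and "\<And>\<mu>. \<alpha> \<mu> = of_real (Re lam0) * \<mu>"
    and "\<And>\<mu>. \<beta> \<mu> = - of_real (Im lam0) * \<mu> + 1"
    and "lam = eig_lam \<alpha> \<beta>" and "nu = eig_nu \<alpha> \<beta>"
  shows "(\<forall>\<mu>. lam \<mu> = lam0 * \<mu> - \<i>) \<and> (\<forall>\<mu>. nu \<mu> = cnj lam0 * \<mu> + \<i>) \<and>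
    (\<exists>M>0. \<forall>C1 C2 C3 C4 S. C1 \<ge> M \<and> C2 \<ge> M \<and> C3 \<ge> M \<and> C4 \<ge> M \<and> S = strip C1 C2 C3 C4 \<longrightarrow>
       ((\<exists>p \<mu>\<^sub>s \<mu>\<^sub>u K. hyp_A1 lam S p \<and> hyp_A2 lam S p \<mu>\<^sub>s \<and> hyp_A3 lam S p \<mu>\<^sub>u \<and>
            hyp_B1 lam nu S p K \<and> hyp_B2 lam S p K \<and> hyp_B3 lam nu S p \<mu>\<^sub>s \<mu>\<^sub>u K)
          \<longleftrightarrow> Re lam0 > sqrt 3 * \<bar>Im lam0\<bar>) \<and>
       (\<forall>p \<mu>\<^sub>s \<mu>\<^sub>u. hyp_A1 lam S p \<and> hyp_A2 lam S p \<mu>\<^sub>s \<and> hyp_A3 lam S p \<mu>\<^sub>u \<longrightarrow>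
            p = \<i> / lam0 \<and> \<mu>\<^sub>s = - (1 / cmod lam0) \<and> \<mu>\<^sub>u = 1 / cmod lam0))"
proof -
  interpret L: linear_eigenvalue lam0
    by standard (rule assms(1))
  have lam0: "lam0 = of_real (Re lam0) + \<i> * of_real (Im lam0)"
    "cnj lam0 = of_real (Re lam0) - \<i> * of_real (Im lam0)"
    by (simp_all add: complex_eq_iff)
  have lam: "lam = (\<lambda>\<mu>. lam0 * \<mu> - \<i>)"
    unfolding assms(4) eig_lam_def assms(2,3) by (subst (3) lam0(1)) (simp add: algebra_simps)
  have nu: "nu = (\<lambda>\<mu>. cnj lam0 * \<mu> + \<i>)"
    unfolding assms(5) eig_nu_def assms(2,3) lam0(2) by (simp add: algebra_simps)
  have main: "((\<exists>p \<mu>\<^sub>s \<mu>\<^sub>u K. hyp_A1 lam S p \<and> hyp_A2 lam S p \<mu>\<^sub>s \<and> hyp_A3 lam S p \<mu>\<^sub>u \<and>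
            hyp_B1 lam nu S p K \<and> hyp_B2 lam S p K \<and> hyp_B3 lam nu S p \<mu>\<^sub>s \<mu>\<^sub>u K)
          \<longleftrightarrow> Re lam0 > sqrt 3 * \<bar>Im lam0\<bar>) \<and>
       (\<forall>p \<mu>\<^sub>s \<mu>\<^sub>u. hyp_A1 lam S p \<and> hyp_A2 lam S p \<mu>\<^sub>s \<and> hyp_A3 lam S p \<mu>\<^sub>u \<longrightarrow>
            p = \<i> / lam0 \<and> \<mu>\<^sub>s = - (1 / cmod lam0) \<and> \<mu>\<^sub>u = 1 / cmod lam0)"
    if S: "convex S" "cball 0 (1 / cmod lam0) \<subseteq> S" for S
    unfolding lam nu
  proof (intro conjI iffI)
    assume "\<exists>p \<mu>\<^sub>s \<mu>\<^sub>u K. hyp_A1 (\<lambda>\<mu>. lam0 * \<mu> - \<i>) S p \<and> hyp_A2 (\<lambda>\<mu>. lam0 * \<mu> - \<i>) S p \<mu>\<^sub>s \<and>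
      hyp_A3 (\<lambda>\<mu>. lam0 * \<mu> - \<i>) S p \<mu>\<^sub>u \<and> hyp_B1 (\<lambda>\<mu>. lam0 * \<mu> - \<i>) (\<lambda>\<mu>. cnj lam0 * \<mu> + \<i>) S p K \<and>
      hyp_B2 (\<lambda>\<mu>. lam0 * \<mu> - \<i>) S p K \<and> hyp_B3 (\<lambda>\<mu>. lam0 * \<mu> - \<i>) (\<lambda>\<mu>. cnj lam0 * \<mu> + \<i>) S p \<mu>\<^sub>s \<mu>\<^sub>u K"
    then obtain p K where A1: "hyp_A1 (\<lambda>\<mu>. lam0 * \<mu> - \<i>) S p"
      and B: "hyp_B1 (\<lambda>\<mu>. lam0 * \<mu> - \<i>) (\<lambda>\<mu>. cnj lam0 * \<mu> + \<i>) S p K" "hyp_B2 (\<lambda>\<mu>. lam0 * \<mu> - \<i>) S p K"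
      by blast
    have "p = \<i> / lam0" using A1 by (simp only: L.hyp_A1_iff[OF S(2)])
    with B show "sqrt 3 * \<bar>Im lam0\<bar> < Re lam0"
      using L.two_b_less_r_if_hyps[OF S] L.two_b_less_r_iff by simp
  next
    assume "sqrt 3 * \<bar>Im lam0\<bar> < Re lam0"
    then have b: "2 * \<bar>Im lam0\<bar> < cmod lam0" by (simp add: L.two_b_less_r_iff)
    show "\<exists>p \<mu>\<^sub>s \<mu>\<^sub>u K. hyp_A1 (\<lambda>\<mu>. lam0 * \<mu> - \<i>) S p \<and> hyp_A2 (\<lambda>\<mu>. lam0 * \<mu> - \<i>) S p \<mu>\<^sub>s \<and>
      hyp_A3 (\<lambda>\<mu>. lam0 * \<mu> - \<i>) S p \<mu>\<^sub>u \<and> hyp_B1 (\<lambda>\<mu>. lam0 * \<mu> - \<i>) (\<lambda>\<mu>. cnj lam0 * \<mu> + \<i>) S p K \<and>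
      hyp_B2 (\<lambda>\<mu>. lam0 * \<mu> - \<i>) S p K \<and> hyp_B3 (\<lambda>\<mu>. lam0 * \<mu> - \<i>) (\<lambda>\<mu>. cnj lam0 * \<mu> + \<i>) S p \<mu>\<^sub>s \<mu>\<^sub>u K"
    proof (rule exI[of _ "\<i> / lam0"], rule exI[of _ "- (1 / cmod lam0)"], rule exI[of _ "1 / cmod lam0"],
        rule exI[of _ "L.central_arc"], intro conjI)
      show "hyp_A1 (\<lambda>\<mu>. lam0 * \<mu> - \<i>) S (\<i> / lam0)"
        by (simp only: L.hyp_A1_iff[OF S(2)])
      show "hyp_A2 (\<lambda>\<mu>. lam0 * \<mu> - \<i>) S (\<i> / lam0) (- (1 / cmod lam0))"
        by (simp only: L.hyp_A2_iff[OF S])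
      show "hyp_A3 (\<lambda>\<mu>. lam0 * \<mu> - \<i>) S (\<i> / lam0) (1 / cmod lam0)"
        by (simp only: L.hyp_A3_iff[OF S])
      show "hyp_B1 (\<lambda>\<mu>. lam0 * \<mu> - \<i>) (\<lambda>\<mu>. cnj lam0 * \<mu> + \<i>) S (\<i> / lam0) L.central_arc"
        by (rule L.hyp_B1_central_arc[OF S(2)])
      show "hyp_B2 (\<lambda>\<mu>. lam0 * \<mu> - \<i>) S (\<i> / lam0) L.central_arc"
        by (rule L.hyp_B2_central_arc[OF S b])
      show "hyp_B3 (\<lambda>\<mu>. lam0 * \<mu> - \<i>) (\<lambda>\<mu>. cnj lam0 * \<mu> + \<i>) S (\<i> / lam0)
          (- (1 / cmod lam0)) (1 / cmod lam0) L.central_arc"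
        by (rule L.hyp_B3_central_arc[OF S less_imp_le[OF b]])
    qed
  next
    show "\<forall>p \<mu>\<^sub>s \<mu>\<^sub>u. hyp_A1 (\<lambda>\<mu>. lam0 * \<mu> - \<i>) S p \<and> hyp_A2 (\<lambda>\<mu>. lam0 * \<mu> - \<i>) S p \<mu>\<^sub>s \<and>
      hyp_A3 (\<lambda>\<mu>. lam0 * \<mu> - \<i>) S p \<mu>\<^sub>u \<longrightarrow>
      p = \<i> / lam0 \<and> \<mu>\<^sub>s = - (1 / cmod lam0) \<and> \<mu>\<^sub>u = 1 / cmod lam0"
    proof (intro allI impI)
      fix p \<mu>\<^sub>s \<mu>\<^sub>u
      assume A: "hyp_A1 (\<lambda>\<mu>. lam0 * \<mu> - \<i>) S p \<and> hyp_A2 (\<lambda>\<mu>. lam0 * \<mu> - \<i>) S p \<mu>\<^sub>s \<and>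
        hyp_A3 (\<lambda>\<mu>. lam0 * \<mu> - \<i>) S p \<mu>\<^sub>u"
      then have p: "p = \<i> / lam0" by (simp only: L.hyp_A1_iff[OF S(2)])
      show "p = \<i> / lam0 \<and> \<mu>\<^sub>s = - (1 / cmod lam0) \<and> \<mu>\<^sub>u = 1 / cmod lam0"
        using A unfolding p by (simp only: L.hyp_A2_iff[OF S] L.hyp_A3_iff[OF S])
    qed
  qed
  (* M = 1 / r: the strip then contains the disc in which the triangle and the arc lie. *)
  show ?thesis
  proof (intro conjI exI[of _ "1 / cmod lam0"] allI impI)
    show "lam \<mu> = lam0 * \<mu> - \<i>" "nu \<mu> = cnj lam0 * \<mu> + \<i>" for \<mu>
      by (simp_all only: lam nu)
    show "1 / cmod lam0 > 0" using L.r_pos by simp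
  next
    fix C1 C2 C3 C4 S
    assume *: "C1 \<ge> 1 / cmod lam0 \<and> C2 \<ge> 1 / cmod lam0 \<and> C3 \<ge> 1 / cmod lam0 \<and> C4 \<ge> 1 / cmod lam0
      \<and> S = strip C1 C2 C3 C4"
    then have S: "convex S" "cball 0 (1 / cmod lam0) \<subseteq> S"
      using strip_convex cball_subset_strip by blast+
    show "(\<exists>p \<mu>\<^sub>s \<mu>\<^sub>u K. hyp_A1 lam S p \<and> hyp_A2 lam S p \<mu>\<^sub>s \<and> hyp_A3 lam S p \<mu>\<^sub>u \<and>
            hyp_B1 lam nu S p K \<and> hyp_B2 lam S p K \<and> hyp_B3 lam nu S p \<mu>\<^sub>s \<mu>\<^sub>u K)
          \<longleftrightarrow> Re lam0 > sqrt 3 * \<bar>Im lam0\<bar>"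
      using main[OF S] by (rule conjunct1)
    show "p = \<i> / lam0" "\<mu>\<^sub>s = - (1 / cmod lam0)" "\<mu>\<^sub>u = 1 / cmod lam0"
      if "hyp_A1 lam S p \<and> hyp_A2 lam S p \<mu>\<^sub>s \<and> hyp_A3 lam S p \<mu>\<^sub>u" for p \<mu>\<^sub>s \<mu>\<^sub>u
      using main[OF S] that by blast+
  qed
qed

end
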